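(* Let $(X,R,\tau)$ be a GCOTS. Then: (1) The family $C_+(X,\mathbb T)$ of all $\tau$-continuous COP maps from $X$ to the circle $\mathbb T$ is $3$-point separating: for any three distinct points $a,b,c\in X$ there is $f\in C_+(X,\mathbb T)$ such that $f(a),f(b),f(c)$ are pairwise distinct. (2) There exist a set $I$ and a $\tau$-topological COP embedding $\nu:X\to\mathbb T^I$ (with $\mathbb T^I$ carrying the product topology and the coordinatewise circular relation) such that the closure $\operatorname{cl}(\nu(X))$ is a compact COTS: the coordinatewise circular relation restricted to $\operatorname{cl}(\nu(X))$ is a circular order whose interval topology is the subspace topology of $\operatorname{cl}(\nu(X))$.
   Context: A circular order on a set $X$ is a ternary relation $R\subseteq X^3$ (write $[a,b,c]$ for $(a,b,c)\in R$) satisfying: cyclicity ($[a,b,c]\Rightarrow[b,c,a]$); asymmetry ($[a,b,c]\Rightarrow (c,b,a)\notin R$); transitivity ($[a,b,c]$ and $[a,c,d]$ imply $[a,b,d]$); totality (if $a,b,c$ are distinct then $[a,b,c]$ or $[a,c,b]$). Put $(a,b)_R:=\{x\in X:[a,x,b]\}$ and $[a,b]_R:=(a,b)_R\cup\{a,b\}$. The interval topology $\lambda_R$ is the topology on $X$ with base $\{X\setminus[a,b]_R: a,b\in X\}\cup\{X\}$. The circle $\mathbb T$ carries its usual topology and its standard (counterclockwise) circular order. A GCOTS is a triple $(X,R,\tau)$ with $R$ a circular order and $\tau$ a topology on $X$ such that there are a circularly ordered set $(Y,R_Y)$ and an injection $i:X\to Y$ which is a topological embedding of $(X,\tau)$ into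 $(Y,\lambda_{R_Y})$ and satisfies $[a,b,c]_R\iff[i(a),i(b),i(c)]_{R_Y}$. A map $f:X_1\to X_2$ of circularly ordered sets is COP if: (COP1) whenever $[a,b,c]$ in $X_1$ and $f(a),f(b),f(c)$ are pairwise distinct, then $[f(a),f(b),f(c)]$ in $X_2$; (COP2) if $f(x)=f(y)$ then $f$ is constant on one of the closed intervals $[x,y]$, $[y,x]$. Coordinatewise circular relation on $\mathbb T^I$: $[u,v,w]$ iff there is at least one $i\in I$ for which $u_i,v_i,w_i$ are pairwise distinct, and $[u_i,v_i,w_i]$ holds in $\mathbb T$ for every $i\in I$ for which $u_i,v_i,w_i$ are pairwise distinct. A "$\tau$-topological COP embedding" $\nu$ is an injection that is a homeomorphism of $(X,\tau)$ onto its image and satisfies $[a,b,c]_R\iff[\nu(a),\nu(b),\nu(c)]$. *)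

theory Defs
  imports "HOL-Analysis.Analysis"
begin

definition circular_order_on :: "'a set \<Rightarrow> ('a \<times> 'a \<times> 'a) set \<Rightarrow> bool" where
  "circular_order_on X R \<longleftrightarrow>
     R \<subseteq> X \<times> X \<times> X \<and>
     (\<forall>a b c. (a, b, c) \<in> R \<longrightarrow> (b, c, a) \<in> R) \<and>
     (\<forall>a b c. (a, b, c) \<in> R \<longrightarrow> (c, b, a) \<notin> R) \<and>
     (\<forall>a b c d. (a, b, c) \<in> R \<and> (a, c, d) \<in> R \<longrightarrow> (a, b, d) \<in> R) \<and>
     (\<forall>a\<in>X. \<forall>b\<in>X. \<forall>c\<in>X. distinct [a, b, c] \<longrightarrow> (a, b, c) \<in> R \<or> (a, c, b) \<in> R)"

definition open_arc :: "('a \<times> 'a \<times> 'a) set \<Rightarrow> 'a \<Rightarrow> 'a \<Rightarrow> 'a set" where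
  "open_arc R a b = {x. (a, x, b) \<in> R}"

definition closed_arc :: "('a \<times> 'a \<times> 'a) set \<Rightarrow> 'a \<Rightarrow> 'a \<Rightarrow> 'a set" where
  "closed_arc R a b = open_arc R a b \<union> {a, b}"

definition interval_base :: "'a set \<Rightarrow> ('a \<times> 'a \<times> 'a) set \<Rightarrow> 'a set set" where
  "interval_base X R = {X - closed_arc R a b | a b. a \<in> X \<and> b \<in> X} \<union> {X}"

(* topology_generated_by only asks for a subbase; openin_interval_topology below shows
   that interval_base is indeed a base whenever R is a circular order on X. *)
definition interval_topology :: "'a set \<Rightarrow> ('a \<times> 'a \<times> 'a) set \<Rightarrow> 'a topology" where
  "interval_topology X R = topology_generated_by (interval_base X R)"

lemma topspace_interval_topology [simp]: "topspace (interval_topology X R) = X"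
  by (auto simp: interval_topology_def interval_base_def)

lemma interval_base_Int:
  assumes R: "circular_order_on X R"
    and U: "U \<in> interval_base X R" and V: "V \<in> interval_base X R"
    and x: "x \<in> U" "x \<in> V"
  shows "\<exists>W\<in>interval_base X R. x \<in> W \<and> W \<subseteq> U \<and> W \<subseteq> V"
proof (cases "U = X \<or> V = X")
  case True
  have "U \<subseteq> X" "V \<subseteq> X" using U V by (auto simp: interval_base_def)
  with True U V x show ?thesis by blast
next
  case False
  have sub: "R \<subseteq> X \<times> X \<times> X"
    and cyc: "\<And>a b c. (a, b, c) \<in> R \<Longrightarrow> (b, c, a) \<in> R"
    and asym: "\<And>a b c. (a, b, c) \<in> R \<Longrightarrow> (c, b, a) \<notin> R"
    and tr: "\<And>a b c d. (a, b, c) \<in> R \<Longrightarrow> (a, c, d) \<in> R \<Longrightarrow> (a, b, d) \<in> R"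
    and tot: "\<And>a b c. \<lbrakk>a \<in> X; b \<in> X; c \<in> X; a \<noteq> b; a \<noteq> c; b \<noteq> c\<rbrakk>
                 \<Longrightarrow> (a, b, c) \<in> R \<or> (a, c, b) \<in> R"
    proof -
    show "R \<subseteq> X \<times> X \<times> X" using R unfolding circular_order_on_def by (elim conjE)
    show "(b, c, a) \<in> R" if "(a, b, c) \<in> R" for a b c
      using R that unfolding circular_order_on_def by metis
    show "(c, b, a) \<notin> R" if "(a, b, c) \<in> R" for a b c
      using R that unfolding circular_order_on_def by metis
    show "(a, b, d) \<in> R" if "(a, b, c) \<in> R" "(a, c, d) \<in> R" for a b c d
      using R that unfolding circular_order_on_def by metis
    show "(a, b, c) \<in> R \<or> (a, c, b) \<in> R"
      if "a \<in> X" "b \<in> X" "c \<in> X" "a \<noteq> b" "a \<noteq> c" "b \<noteq> c" for a b c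
    proof -
      have "\<forall>a\<in>X. \<forall>b\<in>X. \<forall>c\<in>X. distinct [a, b, c] \<longrightarrow> (a, b, c) \<in> R \<or> (a, c, b) \<in> R"
        using R unfolding circular_order_on_def by (elim conjE)
      with that show ?thesis by simp
    qed
  qed
  define le where "le y z \<longleftrightarrow> y = z \<or> (x, y, z) \<in> R" for y z
  obtain a b where ab: "a \<in> X" "b \<in> X" "U = X - closed_arc R a b"
    using U False by (auto simp: interval_base_def)
  obtain c d where cd: "c \<in> X" "d \<in> X" "V = X - closed_arc R c d"
    using V False by (auto simp: interval_base_def)
  have xX: "x \<in> X" using ab x by auto
  have le_trans: "le u w" if "le u v" "le v w" for u v w
    using that tr unfolding le_def by metis
  have le_total: "le u v \<or> le v u" if "u \<in> X" "v \<in> X" "u \<noteq> x" "v \<noteq> x" for u v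
    using that tot[of x u v] xX unfolding le_def by metis
  have arc_le: "le p q" if "p \<in> X" "q \<in> X" "x \<notin> closed_arc R p q" for p q
  proof (rule ccontr)
    assume n: "\<not> le p q"
    with that le_total[of p q] have "(x, q, p) \<in> R"
      by (auto simp: le_def closed_arc_def)
    then have "(p, x, q) \<in> R" using cyc by metis
    with that show False by (simp add: closed_arc_def open_arc_def)
  qed
  have arc: "y \<in> closed_arc R p q \<longleftrightarrow> y \<noteq> x \<and> le p y \<and> le y q"
    if pq: "p \<in> X" "q \<in> X" "p \<noteq> x" "q \<noteq> x" "le p q" and y: "y \<in> X" for p q y
  proof
    assume l: "y \<in> closed_arc R p q"
    show "y \<noteq> x \<and> le p y \<and> le y q"
    proof (cases "y = p \<or> y = q")
      case True
      with pq show ?thesis by (auto simp: le_def)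
    next
      case False
      with l have pyq: "(p, y, q) \<in> R" by (simp add: closed_arc_def open_arc_def)
      have "p \<noteq> q" using pyq cyc asym by metis
      then have xpq: "(x, p, q) \<in> R" using pq by (simp add: le_def)
      have qxp: "(q, x, p) \<in> R" using xpq cyc by metis
      have qpy: "(q, p, y) \<in> R" using pyq cyc by metis
      have "(q, x, y) \<in> R" using tr[OF qxp qpy] .
      then have "(x, y, q) \<in> R" using cyc by metis
      moreover have "(p, q, x) \<in> R" using xpq cyc by metis
      with pyq have "(p, y, x) \<in> R" using tr by metis
      then have "(x, p, y) \<in> R" using cyc by metis
      ultimately show ?thesis unfolding le_def using asym cyc by metis
    qed
  next
    assume r: "y \<noteq> x \<and> le p y \<and> le y q"
    show "y \<in> closed_arc R p q"
    proof (cases "y = p \<or> y = q")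
      case True
      then show ?thesis by (auto simp: closed_arc_def)
    next
      case False
      with r have xpy: "(x, p, y) \<in> R" and xyq: "(x, y, q) \<in> R" by (auto simp: le_def)
      have "(y, q, x) \<in> R" "(y, x, p) \<in> R" using xpy xyq cyc by metis+
      then have "(y, q, p) \<in> R" using tr by metis
      then have "(p, y, q) \<in> R" using cyc by metis
      then show ?thesis by (simp add: closed_arc_def open_arc_def)
    qed
  qed
  have nx: "a \<noteq> x" "b \<noteq> x" "c \<noteq> x" "d \<noteq> x" "x \<notin> closed_arc R a b" "x \<notin> closed_arc R c d"
    using x ab cd by (auto simp: closed_arc_def)
  define p where "p = (if le a c then a else c)"
  define q where "q = (if le b d then d else b)"
  have p: "p \<in> X" "p \<noteq> x" "le p a" "le p c"
    using ab cd nx le_total[of a c] by (auto simp: p_def le_def)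
  have q: "q \<in> X" "q \<noteq> x" "le b q" "le d q"
    using ab cd nx le_total[of b d] by (auto simp: q_def le_def)
  have lab: "le a b" and lcd: "le c d" using arc_le ab cd nx by auto
  have lpq: "le p q" using p q lab le_trans by metis
  have sub2: "y \<in> closed_arc R p q" if "y \<in> X" "y \<in> closed_arc R a b \<or> y \<in> closed_arc R c d" for y
    using that arc[of a b y] arc[of c d y] arc[of p q y] ab cd nx lab lcd lpq p q le_trans
    by metis
  have xW: "x \<notin> closed_arc R p q" using arc[of p q x] p q lpq xX by blast
  have W: "X - closed_arc R p q \<in> interval_base X R"
    using p q by (auto simp: interval_base_def)
  show ?thesis
  proof (rule bexI[OF _ W], intro conjI)
    show "x \<in> X - closed_arc R p q" using xX xW by (rule DiffI)
    show "X - closed_arc R p q \<subseteq> U" "X - closed_arc R p q \<subseteq> V"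
      using sub2 unfolding ab(3) cd(3) by auto
  qed
qed

lemma openin_interval_topology:
  assumes "circular_order_on X R"
  shows "openin (interval_topology X R) = arbitrary union_of (\<lambda>U. U \<in> interval_base X R)"
proof -
  have "\<exists>V. V \<in> interval_base X R \<and> x \<in> V \<and> V \<subseteq> U"
    if "generate_topology_on (interval_base X R) U" "x \<in> U" for U x
    using that
  proof (induction arbitrary: x)
    case Empty
    then show ?case by simp
  next
    case (Int U V)
    then obtain A B where "A \<in> interval_base X R" "x \<in> A" "A \<subseteq> U"
      "B \<in> interval_base X R" "x \<in> B" "B \<subseteq> V" by blast
    with interval_base_Int[OF assms, of A B x] show ?case by blast
  next
    case (UN K)
    then show ?case by (meson Union_iff Union_upper order_trans)
  next
    case (Basis s)
    then show ?case by blast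
  qed
  then show ?thesis
    unfolding openin_topology_base_unique interval_topology_def openin_topology_generated_by_iff
    by (blast intro: generate_topology_on.Basis)
qed

definition circle :: "complex set" where
  "circle = sphere 0 1"

definition circle_top :: "complex topology" where
  "circle_top = top_of_set circle"

(* Counterclockwise order: starting at a and turning in the positive direction,
   b is met before c, and c before completing a full turn. *)
definition circle_order :: "(complex \<times> complex \<times> complex) set" where
  "circle_order = {(cis \<alpha>, cis \<beta>, cis \<gamma>) | \<alpha> \<beta> \<gamma>. \<alpha> < \<beta> \<and> \<beta> < \<gamma> \<and> \<gamma> < \<alpha> + 2 * pi}"

definition COP_map ::
  "'a set \<Rightarrow> ('a \<times> 'a \<times> 'a) set \<Rightarrow> 'b set \<Rightarrow> ('b \<times> 'b \<times> 'b) set \<Rightarrow> ('a \<Rightarrow> 'b) \<Rightarrow> bool" where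
  "COP_map X R Y S f \<longleftrightarrow>
     f \<in> X \<rightarrow> Y \<and>
     (\<forall>a b c. (a, b, c) \<in> R \<and> distinct [f a, f b, f c] \<longrightarrow> (f a, f b, f c) \<in> S) \<and>
     (\<forall>x\<in>X. \<forall>y\<in>X. f x = f y \<longrightarrow> f constant_on closed_arc R x y \<or> f constant_on closed_arc R y x)"

definition C_plus :: "'a set \<Rightarrow> ('a \<times> 'a \<times> 'a) set \<Rightarrow> 'a topology \<Rightarrow> ('a \<Rightarrow> complex) set" where
  "C_plus X R \<tau> = {f. continuous_map \<tau> circle_top f \<and> COP_map X R circle circle_order f}"

definition three_point_separating :: "'a set \<Rightarrow> ('a \<Rightarrow> 'b) set \<Rightarrow> bool" where
  "three_point_separating X F \<longleftrightarrow>
     (\<forall>a\<in>X. \<forall>b\<in>X. \<forall>c\<in>X. distinct [a, b, c] \<longrightarrow> (\<exists>f\<in>F. distinct [f a, f b, f c]))"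

(* Points of the power of the circle are the extensional functions I \<rightarrow>\<^sub>E circle,
   which is the carrier of product_topology. *)
definition torus_top :: "'i set \<Rightarrow> ('i \<Rightarrow> complex) topology" where
  "torus_top I = product_topology (\<lambda>_. circle_top) I"

definition torus_rel ::
  "'i set \<Rightarrow> (('i \<Rightarrow> complex) \<times> ('i \<Rightarrow> complex) \<times> ('i \<Rightarrow> complex)) set" where
  "torus_rel I = {(u, v, w).
     u \<in> I \<rightarrow>\<^sub>E circle \<and> v \<in> I \<rightarrow>\<^sub>E circle \<and> w \<in> I \<rightarrow>\<^sub>E circle \<and>
     (\<exists>i\<in>I. distinct [u i, v i, w i]) \<and>
     (\<forall>i\<in>I. distinct [u i, v i, w i] \<longrightarrow> (u i, v i, w i) \<in> circle_order)}"

definition top_order_embedding ::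
  "'a topology \<Rightarrow> ('a \<times> 'a \<times> 'a) set \<Rightarrow> 'b topology \<Rightarrow> ('b \<times> 'b \<times> 'b) set \<Rightarrow> ('a \<Rightarrow> 'b) \<Rightarrow> bool" where
  "top_order_embedding \<tau> R \<sigma> S \<nu> \<longleftrightarrow>
     embedding_map \<tau> \<sigma> \<nu> \<and>
     (\<forall>a\<in>topspace \<tau>. \<forall>b\<in>topspace \<tau>. \<forall>c\<in>topspace \<tau>. (a, b, c) \<in> R \<longleftrightarrow> (\<nu> a, \<nu> b, \<nu> c) \<in> S)"

(* HOL cannot quantify over types inside a formula, so the type in which the ambient
   circularly ordered set Y lives is a parameter. In the hypothesis of a theorem with 'b left
   free, this amounts to an unrestricted existential quantification over Y. *)
definition GCOTS :: "'b itself \<Rightarrow> 'a set \<Rightarrow> ('a \<times> 'a \<times> 'a) set \<Rightarrow> 'a topology \<Rightarrow> bool" where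
  "GCOTS _ X R \<tau> \<longleftrightarrow>
     topspace \<tau> = X \<and> circular_order_on X R \<and>
     (\<exists>(Y :: 'b set) S i. circular_order_on Y S \<and>
        top_order_embedding \<tau> R (interval_topology Y S) S i)"

definition compact_COTS :: "'a set \<Rightarrow> ('a \<times> 'a \<times> 'a) set \<Rightarrow> 'a topology \<Rightarrow> bool" where
  "compact_COTS X R \<tau> \<longleftrightarrow>
     circular_order_on X R \<and> interval_topology X R = \<tau> \<and> compact_space \<tau>"

end

theory Submission
  imports Defs
begin

text \<open>Call \<open>m\<close> an arc mass on a circularly ordered set \<open>Y\<close> if it assigns to every ordered pair of
  points the mass of the arc between them, additively, with total mass \<open>1\<close> and without atoms in the
  order-topological sense. Then \<open>x \<mapsto> exp (2 \<pi> i m(p, x))\<close> is a continuous COP map. Two facts make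
  this family large: for \<open>p \<noteq> q\<close> there is an arc mass concentrated on the arc from \<open>p\<close> to \<open>q\<close> (a unit
  mass placed between two neighbours if the arc has any, and otherwise the pull-back of Lebesgue measure along a monotone
  map defined from a chain indexed by the dyadic rationals), and arc masses can be averaged.
  Averaging the masses concentrated on the two arcs between \<open>p\<close> and \<open>q\<close> separates \<open>p\<close> from \<open>q\<close>, and
  averaging again separates any three points.

  Pull the family back along \<open>X \<rightarrow> Y\<close> and use it as coordinates of \<open>\<nu>\<close>. If \<open>h\<close> comes from the average
  of the masses of \<open>f\<close> and \<open>g\<close>, then \<open>d(f x, f y)\<close> and \<open>d(g x, g y)\<close> are at most \<open>4 \<pi> d(h x, h y)\<close>.
  Such inequalities pass to the closure \<open>K\<close> of \<open>\<nu>(X)\<close>, so three distinct points of \<open>K\<close> still differ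
  pairwise in a single coordinate. Since orientation is an open condition, the remaining axioms on
  \<open>K\<close> follow by approximation from \<open>X\<close>. The interval topology of \<open>K\<close> is Hausdorff and coarser than
  the compact subspace topology, so the two agree.\<close>

section \<open>Orientation and chords on the unit circle\<close>

text \<open>Twice the signed area of the triangle \<open>a b c\<close>, positive for a
  counterclockwise triple. It is a polynomial in the coordinates, so strict orientation is an open
  condition.\<close>

definition orient :: "complex \<Rightarrow> complex \<Rightarrow> complex \<Rightarrow> real" where
  "orient a b c = Im (cnj (b - a) * (c - a))"

lemma orient_rotate: "orient b c a = orient a b c"
  by (simp add: orient_def algebra_simps)

lemma orient_swap: "orient a c b = - orient a b c"
  by (simp add: orient_def algebra_simps)

text \<open>The factored form shows the sign: for angles increasing within one turn, all three half
  differences lie strictly between 0 and \<open>pi\<close>. The proof rotates the first point to 1,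
  which preserves area.\<close>

lemma orient_cis:
  "orient (cis \<alpha>) (cis \<beta>) (cis \<gamma>) =
     4 * sin ((\<beta> - \<alpha>) / 2) * sin ((\<gamma> - \<beta>) / 2) * sin ((\<gamma> - \<alpha>) / 2)"
proof -
  define x y where "x = (\<beta> - \<alpha>) / 2" and "y = (\<gamma> - \<beta>) / 2"
  have \<beta>: "\<beta> = \<alpha> + 2 * x" and \<gamma>: "\<gamma> = \<alpha> + 2 * (x + y)" by (auto simp: x_def y_def field_simps)
  have r: "orient (u * a) (u * b) (u * c) = (cmod u)\<^sup>2 * orient a b c" for u a b c
    unfolding cmod_power2 by (simp add: orient_def algebra_simps power2_eq_square)
  have "orient (cis \<alpha>) (cis \<beta>) (cis \<gamma>) = orient 1 (cis (2 * x)) (cis (2 * (x + y)))"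
    using r[of "cis \<alpha>" 1 "cis (2 * x)" "cis (2 * (x + y))"] by (simp add: \<beta> \<gamma> cis_mult)
  also have "\<dots> = (cos (2*x) - 1) * sin (2*(x+y)) - sin (2*x) * (cos (2*(x+y)) - 1)"
    by (simp add: orient_def algebra_simps)
  also have "\<dots> = 4 * sin x * sin y * sin (x + y)"
  proof -
    have e: "cos (2*x) - 1 = - 2 * (sin x)\<^sup>2" "cos (2*(x+y)) - 1 = - 2 * (sin (x+y))\<^sup>2"
      using cos_double_sin[of x] cos_double_sin[of "x + y"] by simp_all
    have "(cos (2*x) - 1) * sin (2*(x+y)) - sin (2*x) * (cos (2*(x+y)) - 1) =
        4 * sin x * sin (x + y) * (sin (x + y) * cos x - cos (x + y) * sin x)"
      unfolding e sin_double[of x] sin_double[of "x + y"] by algebra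
    also have "sin (x + y) * cos x - cos (x + y) * sin x = sin y"
      using sin_diff[of "x+y" x] by simp
    finally show ?thesis by simp
  qed
  also have "x + y = (\<gamma> - \<alpha>) / 2" by (simp add: x_def y_def field_simps)
  finally show ?thesis by (simp add: x_def y_def)
qed

lemma circle_order_imp_orient:
  assumes "(a, b, c) \<in> circle_order"
  shows "orient a b c > 0"
proof -
  obtain \<alpha> \<beta> \<gamma> where "a = cis \<alpha>" "b = cis \<beta>" "c = cis \<gamma>" "\<alpha> < \<beta>" "\<beta> < \<gamma>" "\<gamma> < \<alpha> + 2 * pi"
    using assms by (auto simp: circle_order_def)
  then show ?thesis
    by (auto simp: orient_cis intro!: mult_pos_pos sin_gt_zero)
qed

lemma circle_cis_ge:
  assumes "z \<in> circle"
  shows "\<exists>\<beta>. z = cis \<beta> \<and> \<alpha> \<le> \<beta> \<and> \<beta> < \<alpha> + 2 * pi"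
proof -
  have z: "cmod z = 1" using assms by (simp add: circle_def)
  define \<theta> where "\<theta> = Arg2pi (z / cis \<alpha>)"
  have "z / cis \<alpha> = cis \<theta>"
    using Arg2pi_eq[of "z / cis \<alpha>"] z by (simp add: \<theta>_def norm_divide cis_conv_exp)
  then have "z = cis (\<alpha> + \<theta>)" by (simp add: field_simps flip: cis_mult)
  moreover have "0 \<le> \<theta>" "\<theta> < 2 * pi"
    using Arg2pi[of "z / cis \<alpha>"] by (auto simp: \<theta>_def)
  ultimately show ?thesis by (intro exI[of _ "\<alpha> + \<theta>"]) auto
qed

text \<open>With the angles of \<open>b\<close> and \<open>c\<close> chosen in the turn that starts
  at \<open>a\<close>, the cyclic arrangement becomes a comparison of two reals.\<close>

lemma circle_order_cases:
  assumes "a \<in> circle" "b \<in> circle" "c \<in> circle" "distinct [a, b, c]"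
  shows "(a, b, c) \<in> circle_order \<or> (a, c, b) \<in> circle_order"
proof -
  obtain \<alpha> where \<alpha>: "a = cis \<alpha>" using circle_cis_ge[OF assms(1)] by blast
  obtain \<beta> where \<beta>: "b = cis \<beta>" "\<alpha> \<le> \<beta>" "\<beta> < \<alpha> + 2 * pi"
    using circle_cis_ge[OF assms(2)] by blast
  obtain \<gamma> where \<gamma>: "c = cis \<gamma>" "\<alpha> \<le> \<gamma>" "\<gamma> < \<alpha> + 2 * pi"
    using circle_cis_ge[OF assms(3)] by blast
  have "\<alpha> \<noteq> \<beta>" "\<alpha> \<noteq> \<gamma>" "\<beta> \<noteq> \<gamma>" using assms(4) \<alpha> \<beta>(1) \<gamma>(1) by auto
  then consider "\<alpha> < \<beta>" "\<beta> < \<gamma>" | "\<alpha> < \<gamma>" "\<gamma> < \<beta>" using \<beta> \<gamma> by linarith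
  then show ?thesis
    by cases (use \<alpha> \<beta> \<gamma> in \<open>auto simp: circle_order_def\<close>)
qed

lemma orient_pos_distinct: "orient a b c > 0 \<Longrightarrow> distinct [a, b, c]"
  by (auto simp: orient_def algebra_simps)

text \<open>One of the two cyclic arrangements of distinct points holds, and exchanging two points
  changes the sign. This trades the existential over angles for a polynomial inequality.\<close>

lemma circle_order_iff_orient:
  assumes "a \<in> circle" "b \<in> circle" "c \<in> circle"
  shows "(a, b, c) \<in> circle_order \<longleftrightarrow> orient a b c > 0"
  using circle_order_imp_orient[of a b c] circle_order_imp_orient[of a c b]
    circle_order_cases[OF assms] orient_swap[of a b c] orient_pos_distinct[of a b c]
  by fastforce

lemma open_orient: "open {z. orient z s t > 0}"
  unfolding orient_def by (intro open_Collect_less continuous_intros)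

section \<open>Chord length against arc length\<close>

lemma chord_cis: "cmod (cis \<alpha> - cis \<beta>) = 2 * \<bar>sin ((\<alpha> - \<beta>) / 2)\<bar>"
proof -
  define x y where "x = (\<alpha> - \<beta>) / 2" and "y = (\<alpha> + \<beta>) / 2"
  have e: "\<alpha> = y + x" "\<beta> = y - x" by (auto simp: x_def y_def field_simps)
  have "cis \<alpha> - cis \<beta> = cis y * (2 * \<i> * sin x)"
    by (simp add: e complex_eq_iff cos_add cos_diff sin_add sin_diff)
  then show ?thesis by (simp add: norm_mult x_def)
qed

text \<open>A weak Jordan inequality. For \<open>y = x / 2\<close>, at most \<open>pi / 4\<close>,
  the bounds \<open>sin y \<ge> y * cos y\<close> (mean value theorem) and
  \<open>cos y * cos y \<ge> 1 / 2\<close> enter the double angle formula.\<close>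

lemma sin_ge_half:
  fixes x :: real
  assumes "0 \<le> x" "x \<le> pi / 2"
  shows "x / 2 \<le> sin x"
proof -
  define y where "y = x / 2"
  have y: "0 \<le> y" "y \<le> pi / 4" using assms by (auto simp: y_def)
  have sy: "sin y \<ge> y * cos y"
  proof (cases "y = 0")
    case False
    then obtain z where z: "0 < z" "z < y" "sin y - sin 0 = (y - 0) * cos z"
      using MVT2[of 0 y sin cos] y by (auto intro: DERIV_sin)
    have "cos y \<le> cos z"
      using z y pi_gt_zero by (intro cos_monotone_0_pi_le) auto
    then show ?thesis using z y by (simp add: mult_left_mono)
  qed simp
  have "cos (pi / 4) \<le> cos y" using y pi_gt_zero by (intro cos_monotone_0_pi_le) auto
  then have "sqrt 2 / 2 \<le> cos y" by (simp add: cos_45)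
  then have "(sqrt 2 / 2)\<^sup>2 \<le> (cos y)\<^sup>2" by (intro power_mono) auto
  then have c2: "1 / 2 \<le> cos y * cos y" by (simp add: power2_eq_square)
  have cy: "0 \<le> cos y" using \<open>sqrt 2 / 2 \<le> cos y\<close> by (smt (verit) real_sqrt_ge_0_iff divide_nonneg_pos)
  have "x / 2 \<le> 2 * y * (cos y * cos y)"
    using mult_left_mono[OF c2, of "2 * y"] y by (simp add: y_def)
  also have "\<dots> \<le> 2 * sin y * cos y"
    using mult_right_mono[OF sy cy] by (simp add: mult_ac)
  also have "\<dots> = sin x" using sin_double[of y] by (simp add: y_def)
  finally show ?thesis .
qed

text \<open>Measures angles in full turns, so that a total mass of 1 is one circuit.\<close>

definition wrap :: "real \<Rightarrow> complex" where
  "wrap t = cis (2 * pi * t)"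

lemma wrap_in_circle [simp]: "wrap t \<in> circle"
  by (simp add: wrap_def circle_def)

lemma wrap_add_1 [simp]: "wrap (t + 1) = wrap t"
  by (simp add: wrap_def distrib_left flip: cis_mult)

lemma dist_wrap: "dist (wrap s) (wrap t) = 2 * \<bar>sin (pi * (s - t))\<bar>"
proof -
  have "(2 * pi * s - 2 * pi * t) / 2 = pi * (s - t)" by (simp add: field_simps)
  then show ?thesis by (simp only: wrap_def dist_norm chord_cis)
qed

lemma dist_wrap_le: "dist (wrap s) (wrap t) \<le> 2 * pi * \<bar>s - t\<bar>"
  using abs_sin_x_le_abs_x[of "pi * (s - t)"] by (simp add: dist_wrap abs_mult)

text \<open>Together with \<open>dist_wrap_le\<close>, this makes the chord comparable to the
  shorter of the two arcs. Reflection reduces to at most half a turn, where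
  \<open>sin_ge_half\<close> applies.\<close>

lemma dist_wrap_ge:
  assumes "0 \<le> t - s" "t - s \<le> 1"
  shows "min (t - s) (1 - (t - s)) \<le> dist (wrap s) (wrap t)"
proof -
  define u where "u = min (t - s) (1 - (t - s))"
  have u: "0 \<le> u" "u \<le> 1 / 2" using assms unfolding u_def by linarith+
  have "sin (pi * (1 - (t - s))) = sin (pi * (t - s))"
    by (simp add: right_diff_distrib sin_diff)
  then have "sin (pi * u) = sin (pi * (t - s))" by (simp add: u_def min_def)
  moreover have "pi * u / 2 \<le> sin (pi * u)"
    using u by (intro sin_ge_half) (auto simp: field_simps)
  ultimately have "pi * u \<le> dist (wrap t) (wrap s)" by (simp add: dist_wrap)
  moreover have "1 * u \<le> pi * u" using u pi_ge_two by (intro mult_right_mono) auto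
  ultimately show ?thesis by (simp add: u_def dist_commute)
qed

lemma wrap_circle_order:
  assumes "s < t" "t < u" "u < s + 1"
  shows "(wrap s, wrap t, wrap u) \<in> circle_order"
proof -
  have "2 * pi * u < 2 * pi * s + 2 * pi"
    using mult_strict_left_mono[OF assms(3), of "2 * pi"] by (simp add: distrib_left)
  then show ?thesis
    unfolding circle_order_def wrap_def using assms by fastforce
qed

section \<open>Arc masses\<close>

locale circular_order =
  fixes Y :: "'b set" and S :: "('b \<times> 'b \<times> 'b) set"
  assumes circular: "circular_order_on Y S"
begin

lemma in_carrier: "(a, b, c) \<in> S \<Longrightarrow> a \<in> Y \<and> b \<in> Y \<and> c \<in> Y"
  using circular unfolding circular_order_on_def by blast

lemma rotate: "(a, b, c) \<in> S \<Longrightarrow> (b, c, a) \<in> S"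
  using circular unfolding circular_order_on_def by blast

lemma asym: "(a, b, c) \<in> S \<Longrightarrow> (c, b, a) \<notin> S"
  using circular unfolding circular_order_on_def by blast

lemma trans: "(a, b, c) \<in> S \<Longrightarrow> (a, c, d) \<in> S \<Longrightarrow> (a, b, d) \<in> S"
  using circular unfolding circular_order_on_def by blast

lemma total:
  assumes "a \<in> Y" "b \<in> Y" "c \<in> Y" "distinct [a, b, c]"
  shows "(a, b, c) \<in> S \<or> (a, c, b) \<in> S"
  using circular assms unfolding circular_order_on_def by blast

text \<open>A triple with a repetition has its reversal among its rotations, which asymmetry
  forbids.\<close>

lemma distinct: "(a, b, c) \<in> S \<Longrightarrow> a \<noteq> b \<and> b \<noteq> c \<and> a \<noteq> c"
  using asym[of a b c] rotate[of a b c] rotate[of b c a] asym[of b c a] asym[of c a b]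
    rotate[of c a b] by auto

text \<open>Rotated to start at \<open>c\<close>, the hypotheses read \<open>(c, d, a)\<close> and
  \<open>(c, a, b)\<close>; transitivity then gives \<open>(c, d, b)\<close>.\<close>

lemma trans': "(a, b, c) \<in> S \<Longrightarrow> (a, c, d) \<in> S \<Longrightarrow> (b, c, d) \<in> S"
  using trans[of c d a b] rotate[of a b c] rotate[of b c a] rotate[of a c d] rotate[of c d b]
    rotate[of d b c] by blast

lemma open_Diff_closed_arc:
  "a \<in> Y \<Longrightarrow> b \<in> Y \<Longrightarrow> openin (interval_topology Y S) (Y - closed_arc S a b)"
  unfolding interval_topology_def openin_topology_generated_by_iff
  by (rule generate_topology_on.Basis) (auto simp: interval_base_def)

lemma closed_arc_same: "closed_arc S a a = {a}"
  using distinct by (auto simp: closed_arc_def open_arc_def)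

text \<open>Combines a bound \<open>z\<close> on one side of \<open>x\<close> with a bound
  \<open>w\<close> on the other. If \<open>z\<close> comes first after \<open>x\<close>, the closed
  arc from \<open>z\<close> to \<open>w\<close> is removed.\<close>

lemma interval_topology_nhd:
  assumes "x \<in> Y" "z \<in> Y" "w \<in> Y" "z \<noteq> x" "w \<noteq> x"
  shows "\<exists>U. openin (interval_topology Y S) U \<and> x \<in> U \<and>
    (\<forall>y\<in>U. y = x \<or> (x, y, z) \<in> S \<or> (w, y, x) \<in> S)"
proof (cases "(x, z, w) \<in> S")
  case True
  have "x \<notin> closed_arc S z w"
    using True assms rotate asym by (metis Un_iff closed_arc_def empty_iff insertE mem_Collect_eq open_arc_def)
  moreover have "y = x \<or> (x, y, z) \<in> S \<or> (w, y, x) \<in> S" if "y \<in> Y - closed_arc S z w" for y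
  proof -
    have y: "y \<in> Y" "y \<noteq> z" "y \<noteq> w" "(z, y, w) \<notin> S"
      using that by (auto simp: closed_arc_def open_arc_def)
    show ?thesis
    proof (rule ccontr)
      assume c: "\<not> ?thesis"
      then have "(z, y, x) \<in> S" using total[of x y z] y assms rotate by auto
      moreover have "(z, w, y) \<in> S" using total[of z y w] y assms distinct[OF True] by auto
      ultimately show False using c trans' by blast
    qed
  qed
  ultimately show ?thesis
    using open_Diff_closed_arc[of z w] assms by blast
next
  case False
  \<comment> \<open>Here the two arcs overlap or \<open>z = w\<close>, so removing the single point
    \<open>z\<close> is enough.\<close>
  have "y = x \<or> (x, y, z) \<in> S \<or> (w, y, x) \<in> S" if y: "y \<in> Y - {z}" for y
  proof (rule ccontr)
    assume c: "\<not> ?thesis"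
    then have xzy: "(x, z, y) \<in> S" using total[of x y z] y assms by auto
    have "z = w \<or> (x, w, z) \<in> S" using False total[of x z w] assms by auto
    then have "(x, w, y) \<in> S" using xzy trans by blast
    then show False using c rotate by blast
  qed
  then show ?thesis
    using open_Diff_closed_arc[of z z] assms by (intro exI[of _ "Y - {z}"]) (auto simp: closed_arc_same)
qed

end

text \<open>The intended reading of \<open>m x y\<close> is the mass that a probability measure on a circle into which
  \<open>Y\<close> maps gives to the arc from the image of \<open>x\<close> to that of \<open>y\<close>. The last two clauses are
  one-sided continuity; unlike continuity of the map into the circle they survive averaging.\<close>

definition arc_mass :: "'b set \<Rightarrow> ('b \<times> 'b \<times> 'b) set \<Rightarrow> ('b \<Rightarrow> 'b \<Rightarrow> real) \<Rightarrow> bool" where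
  "arc_mass Y S m \<longleftrightarrow>
     (\<forall>x\<in>Y. m x x = 0) \<and>
     (\<forall>x\<in>Y. \<forall>y\<in>Y. 0 \<le> m x y) \<and>
     (\<forall>x\<in>Y. \<forall>y\<in>Y. x \<noteq> y \<longrightarrow> m x y + m y x = 1) \<and>
     (\<forall>x y z. (x, y, z) \<in> S \<longrightarrow> m x z = m x y + m y z) \<and>
     (\<forall>x\<in>Y. \<forall>e>0. \<exists>z\<in>Y - {x}. \<forall>y. (x, y, z) \<in> S \<longrightarrow> m x y < e) \<and>
     (\<forall>x\<in>Y. \<forall>e>0. \<exists>z\<in>Y - {x}. \<forall>y. (z, y, x) \<in> S \<longrightarrow> m y x < e)"

section \<open>The circle-valued map of an arc mass\<close>

locale circular_order_mass = circular_order +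
  fixes m :: "'b \<Rightarrow> 'b \<Rightarrow> real"
  assumes mass: "arc_mass Y S m"
begin

lemma mass_self [simp]: "x \<in> Y \<Longrightarrow> m x x = 0"
  using mass by (simp add: arc_mass_def)

lemma mass_nonneg: "x \<in> Y \<Longrightarrow> y \<in> Y \<Longrightarrow> 0 \<le> m x y"
  using mass by (simp add: arc_mass_def)

lemma mass_complement: "x \<in> Y \<Longrightarrow> y \<in> Y \<Longrightarrow> x \<noteq> y \<Longrightarrow> m x y + m y x = 1"
  using mass by (simp add: arc_mass_def)

lemma mass_add: "(x, y, z) \<in> S \<Longrightarrow> m x z = m x y + m y z"
  using mass unfolding arc_mass_def by blast

lemma mass_right: "x \<in> Y \<Longrightarrow> e > 0 \<Longrightarrow> \<exists>z\<in>Y - {x}. \<forall>y. (x, y, z) \<in> S \<longrightarrow> m x y < e"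
  using mass unfolding arc_mass_def by blast

lemma mass_left: "x \<in> Y \<Longrightarrow> e > 0 \<Longrightarrow> \<exists>z\<in>Y - {x}. \<forall>y. (z, y, x) \<in> S \<longrightarrow> m y x < e"
  using mass unfolding arc_mass_def by blast

lemma mass_le_1: "x \<in> Y \<Longrightarrow> y \<in> Y \<Longrightarrow> m x y \<le> 1"
  using mass_complement[of x y] mass_nonneg[of y x] by (cases "x = y") auto

text \<open>Going from \<open>x\<close> to \<open>z\<close> by way of \<open>y\<close> costs either
  no excess or exactly one full turn, which \<open>wrap\<close> forgets.\<close>

lemma wrap_mass_add:
  assumes "x \<in> Y" "y \<in> Y" "z \<in> Y"
  shows "wrap (m x z) = wrap (m x y + m y z)"
proof -
  consider "x = y \<or> y = z" | "x = z" "x \<noteq> y" | "(x, y, z) \<in> S" | "(x, z, y) \<in> S" "distinct [x, y, z]"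
    using total[of x y z] assms by auto
  then show ?thesis
  proof cases
    case 1 then show ?thesis using assms by auto
  next
    case 2
    then show ?thesis using mass_complement[of x y] assms wrap_add_1[of 0] by simp
  next
    case 3 then show ?thesis by (simp add: mass_add)
  next
    case 4
    then have "m x y + m y z = m x z + 1"
      using mass_add[of x z y] mass_complement[of y z] assms by auto
    then show ?thesis by simp
  qed
qed

text \<open>Another base point in \<open>Y\<close> would only rotate the map.\<close>

definition mass_map :: "'b \<Rightarrow> 'b \<Rightarrow> complex" where
  "mass_map p x = wrap (m p x)"

lemma mass_map_in_circle [simp]: "mass_map p x \<in> circle"
  by (simp add: mass_map_def)

context
  fixes p assumes p: "p \<in> Y"
begin

lemma dist_mass_map_le:
  assumes "x \<in> Y" "y \<in> Y"
  shows "dist (mass_map p x) (mass_map p y) \<le> 2 * pi * m x y"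
  using dist_wrap_le[of "m p x" "m p x + m x y"] assms mass_nonneg
  by (simp add: mass_map_def wrap_mass_add[OF p assms])

lemma dist_mass_map_ge:
  assumes "x \<in> Y" "y \<in> Y"
  shows "min (m x y) (m y x) \<le> dist (mass_map p x) (mass_map p y)"
proof (cases "x = y")
  case False
  then have "m y x = 1 - m x y" using mass_complement[OF assms] by simp
  then show ?thesis
    using dist_wrap_ge[of "m p x + m x y" "m p x"] assms mass_nonneg mass_le_1
    by (simp add: mass_map_def wrap_mass_add[OF p assms])
qed (use assms in simp)

lemma mass_map_eq_iff:
  assumes "x \<in> Y" "y \<in> Y"
  shows "mass_map p x = mass_map p y \<longleftrightarrow> m x y = 0 \<or> m y x = 0"
proof
  show "m x y = 0 \<or> m y x = 0" if "mass_map p x = mass_map p y"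
    using dist_mass_map_ge[OF assms] that mass_nonneg[OF assms] mass_nonneg[of y x] assms
    by (auto simp: min_def split: if_splits)
  show "mass_map p x = mass_map p y" if "m x y = 0 \<or> m y x = 0"
    using that dist_mass_map_le[OF assms] dist_mass_map_le[of y x] assms by auto
qed

text \<open>The one-sided clauses of \<open>arc_mass\<close> bound \<open>x\<close> on each side,
  and \<open>interval_topology_nhd\<close> joins the sides. The radius \<open>e / (2 * pi)\<close>
  compensates the Lipschitz constant of \<open>wrap\<close>.\<close>

lemma continuous_mass_map: "continuous_map (interval_topology Y S) circle_top (mass_map p)"
proof -
  have "openin (interval_topology Y S) {x \<in> Y. mass_map p x \<in> W}" if W: "open W" for W
  proof (subst openin_subopen, intro ballI)
    fix x assume "x \<in> {x \<in> Y. mass_map p x \<in> W}"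
    then have x: "x \<in> Y" "mass_map p x \<in> W" by auto
    then obtain e where e: "e > 0" "\<And>u. dist u (mass_map p x) < e \<Longrightarrow> u \<in> W"
      using W by (meson open_dist)
    obtain z where z: "z \<in> Y - {x}" "\<And>y. (x, y, z) \<in> S \<Longrightarrow> m x y < e / (2 * pi)"
      using mass_right[of x "e / (2 * pi)"] x e by auto
    obtain w where w: "w \<in> Y - {x}" "\<And>y. (w, y, x) \<in> S \<Longrightarrow> m y x < e / (2 * pi)"
      using mass_left[of x "e / (2 * pi)"] x e by auto
    obtain U where U: "openin (interval_topology Y S) U" "x \<in> U"
      "\<And>y. y \<in> U \<Longrightarrow> y = x \<or> (x, y, z) \<in> S \<or> (w, y, x) \<in> S"
      using interval_topology_nhd[of x z w] x z w by auto
    have UY: "U \<subseteq> Y" using openin_subset[OF U(1)] by simp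
    have "dist (mass_map p y) (mass_map p x) < e" if y: "y \<in> U" for y
    proof -
      consider "y = x" | "m x y < e / (2 * pi)" | "m y x < e / (2 * pi)"
        using U(3)[OF y] z w by blast
      then show ?thesis
      proof cases
        case 1 then show ?thesis using e by simp
      next
        case 2
        then have "2 * pi * m x y < e" by (simp add: field_simps)
        then show ?thesis using dist_mass_map_le[of x y] x UY y by (auto simp: dist_commute)
      next
        case 3
        then have "2 * pi * m y x < e" by (simp add: field_simps)
        then show ?thesis using dist_mass_map_le[of y x] x UY y by auto
      qed
    qed
    then show "\<exists>T. openin (interval_topology Y S) T \<and> x \<in> T \<and> T \<subseteq> {x \<in> Y. mass_map p x \<in> W}"
      using U UY e by blast
  qed
  then have "continuous_map (interval_topology Y S) euclidean (mass_map p)"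
    by (simp add: continuous_map_def)
  then show ?thesis by (auto simp: circle_top_def continuous_map_in_subtopology)
qed

lemma mass_map_circle_order:
  assumes "(a, b, c) \<in> S" "distinct [mass_map p a, mass_map p b, mass_map p c]"
  shows "(mass_map p a, mass_map p b, mass_map p c) \<in> circle_order"
proof -
  have Y: "a \<in> Y" "b \<in> Y" "c \<in> Y" using in_carrier[OF assms(1)] by auto
  have "m a b > 0" "m b c > 0" "m c a > 0"
    using assms(2) Y mass_map_eq_iff mass_nonneg by (auto simp: less_le)
  moreover have "m a b + m b c + m c a = 1"
    using mass_add[OF assms(1)] mass_complement[of a c] Y distinct[OF assms(1)] by auto
  \<comment> \<open>The three arcs have positive masses with sum 1, so the lifts increase strictly
    within one turn.\<close>
  ultimately have "(wrap (m p a), wrap (m p a + m a b), wrap (m p a + m a c)) \<in> circle_order"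
    using mass_add[OF assms(1)] by (intro wrap_circle_order) auto
  then show ?thesis
    using wrap_mass_add[OF p Y(1,2)] wrap_mass_add[OF p Y(1,3)] by (simp add: mass_map_def)
qed

lemma mass_map_constant:
  assumes "x \<in> Y" "y \<in> Y" "m x y = 0" "(x, z, y) \<in> S"
  shows "mass_map p z = mass_map p x"
proof -
  have "z \<in> Y" using in_carrier[OF assms(4)] by simp
  moreover have "m x z = 0"
    using mass_add[OF assms(4)] assms mass_nonneg[of x z] mass_nonneg[of z y] \<open>z \<in> Y\<close> by auto
  ultimately show ?thesis using mass_map_eq_iff[of x z] assms by auto
qed

text \<open>Equal values make one of the two arcs null, and subarcs of a null arc are null. This
  yields the second COP axiom.\<close>

lemma mass_map_eq_constant:
  assumes "x \<in> Y" "y \<in> Y" "mass_map p x = mass_map p y"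
  shows "(\<forall>z\<in>closed_arc S x y. mass_map p z = mass_map p x) \<or>
    (\<forall>z\<in>closed_arc S y x. mass_map p z = mass_map p x)"
proof -
  have c: "mass_map p z = mass_map p u"
    if "u \<in> Y" "v \<in> Y" "m u v = 0" "mass_map p u = mass_map p v" "z \<in> closed_arc S u v" for u v z
    using that mass_map_constant[OF that(1-3)] by (auto simp: closed_arc_def open_arc_def)
  have "m x y = 0 \<or> m y x = 0" using assms mass_map_eq_iff by simp
  then show ?thesis using c[of x y] c[of y x] assms by metis
qed

text \<open>Travelling from \<open>q\<close> to \<open>x\<close> passes \<open>a\<close>, and
  travelling from \<open>x\<close> back to \<open>q\<close> passes \<open>b\<close>, so both arcs
  carry mass bounded below independently of \<open>x\<close>.\<close>

lemma mass_map_avoids_closed_arc: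
  assumes q: "q \<in> Y" and ab: "a \<in> Y" "b \<in> Y" "q \<notin> closed_arc S a b"
    and x: "x \<in> closed_arc S a b"
  shows "min (m q a) (m b q) \<le> dist (mass_map p x) (mass_map p q)"
proof -
  have xY: "x \<in> Y" using x ab in_carrier by (auto simp: closed_arc_def open_arc_def)
  have q': "q \<noteq> a" "q \<noteq> b" "(a, q, b) \<notin> S"
    using ab by (auto simp: closed_arc_def open_arc_def)
  have abq: "a = b \<or> (a, b, q) \<in> S" using total[of a b q] q q' ab by auto
  consider "x = a" | "x = b" | "(a, x, b) \<in> S" using x by (auto simp: closed_arc_def open_arc_def)
  then have "(x = a \<or> (q, a, x) \<in> S) \<and> (x = b \<or> (x, b, q) \<in> S)"
  proof cases
    case 1 then show ?thesis using abq by blast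
  next
    case 2 then show ?thesis using abq rotate by blast
  next
    case 3
    then have "(a, b, q) \<in> S" using abq distinct by blast
    then have "(a, x, q) \<in> S" "(x, b, q) \<in> S" using 3 trans trans' by blast+
    then show ?thesis using rotate by blast
  qed
  then have qax: "x = a \<or> (q, a, x) \<in> S" and xbq: "x = b \<or> (x, b, q) \<in> S" by blast+
  have "m q a \<le> m q x"
    using qax mass_add[of q a x] mass_nonneg[of a x] ab xY by auto
  moreover have "m b q \<le> m x q"
    using xbq mass_add[of x b q] mass_nonneg[of x b] ab xY by auto
  ultimately show ?thesis using dist_mass_map_ge[OF xY q] by linarith
qed

end

end

context circular_order
begin

text \<open>For one-sided continuity, the nearer of the two bounding points serves both
  masses.\<close>

lemma arc_mass_average:
  assumes "arc_mass Y S m" "arc_mass Y S n"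
  shows "arc_mass Y S (\<lambda>x y. (m x y + n x y) / 2)"
proof -
  interpret m: circular_order_mass Y S m by unfold_locales fact
  interpret n: circular_order_mass Y S n by unfold_locales fact
  have r: "\<exists>z\<in>Y - {x}. \<forall>y. (x, y, z) \<in> S \<longrightarrow> (m x y + n x y) / 2 < e" if "x \<in> Y" "e > 0" for x e
  proof -
    obtain z w where z: "z \<in> Y - {x}" "\<And>y. (x, y, z) \<in> S \<Longrightarrow> m x y < e"
      and w: "w \<in> Y - {x}" "\<And>y. (x, y, w) \<in> S \<Longrightarrow> n x y < e"
      using m.mass_right[OF \<open>x \<in> Y\<close> \<open>e > 0\<close>] n.mass_right[OF \<open>x \<in> Y\<close> \<open>e > 0\<close>] by blast
    consider "z = w" | "(x, z, w) \<in> S" | "(x, w, z) \<in> S"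
      using total[of x z w] z w \<open>x \<in> Y\<close> by auto
    then show ?thesis
    proof cases
      case 1 then show ?thesis using z w by (fastforce intro!: bexI[of _ z])
    next
      case 2 then show ?thesis using z w trans by (fastforce intro!: bexI[of _ z])
    next
      case 3 then show ?thesis using z w trans by (fastforce intro!: bexI[of _ w])
    qed
  qed
  have l: "\<exists>z\<in>Y - {x}. \<forall>y. (z, y, x) \<in> S \<longrightarrow> (m y x + n y x) / 2 < e" if "x \<in> Y" "e > 0" for x e
  proof -
    obtain z w where z: "z \<in> Y - {x}" "\<And>y. (z, y, x) \<in> S \<Longrightarrow> m y x < e"
      and w: "w \<in> Y - {x}" "\<And>y. (w, y, x) \<in> S \<Longrightarrow> n y x < e"
      using m.mass_left[OF \<open>x \<in> Y\<close> \<open>e > 0\<close>] n.mass_left[OF \<open>x \<in> Y\<close> \<open>e > 0\<close>] by blast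
    have tr: "(b, y, x) \<in> S" if "(a, y, x) \<in> S" "(x, b, a) \<in> S" for a b y
      using that trans' rotate by metis
    consider "z = w" | "(x, z, w) \<in> S" | "(x, w, z) \<in> S"
      using total[of x z w] z w \<open>x \<in> Y\<close> by auto
    then show ?thesis
    proof cases
      case 1 then show ?thesis using z w by (fastforce intro!: bexI[of _ z])
    next
      case 2 then show ?thesis using z w tr by (fastforce intro!: bexI[of _ w])
    next
      case 3 then show ?thesis using z w tr by (fastforce intro!: bexI[of _ z])
    qed
  qed
  have "(m x y + n x y) / 2 + (m y x + n y x) / 2 = 1" if "x \<in> Y" "y \<in> Y" "x \<noteq> y" for x y
    using m.mass_complement[OF that] n.mass_complement[OF that] by (simp add: field_simps)
  moreover have "(m x z + n x z) / 2 = (m x y + n x y) / 2 + (m y z + n y z) / 2"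
    if "(x, y, z) \<in> S" for x y z
    using m.mass_add[OF that] n.mass_add[OF that] by (simp add: field_simps)
  ultimately show ?thesis
    unfolding arc_mass_def using m.mass_nonneg n.mass_nonneg r l
    by (intro conjI allI ballI impI) simp_all
qed

end

section \<open>Arc masses concentrated on an arc\<close>

lemma dyadic_between:
  fixes s t :: real
  assumes "0 \<le> s" "s < t" "t \<le> 1"
  shows "\<exists>r\<in>dyadics. 0 \<le> r \<and> r \<le> 1 \<and> s < r \<and> r < t"
proof -
  obtain u where u: "s < u" "u < t" using dense assms by blast
  then have "u \<in> closure ({s<..<t} \<inter> dyadics)"
    unfolding dyadics_def using assms
    by (subst closure_dyadic_rationals_in_convex_set_pos_1) (auto simp: interior_open)
  then have "{s<..<t} \<inter> dyadics \<noteq> {}" by auto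
  then show ?thesis using assms by force
qed

context circular_order
begin

text \<open>The strict linear order left after cutting the circle open at \<open>p\<close>, with
  \<open>p\<close> as least element.\<close>

definition before :: "'b \<Rightarrow> 'b \<Rightarrow> 'b \<Rightarrow> bool" where
  "before p x y \<longleftrightarrow> (x = p \<and> y \<noteq> p) \<or> (p, x, y) \<in> S"

context
  fixes p assumes p: "p \<in> Y"
begin

lemma before_irrefl [simp]: "\<not> before p x x"
  using distinct by (auto simp: before_def)

lemma before_base [simp]: "\<not> before p x p" "before p p x \<longleftrightarrow> x \<noteq> p"
  using distinct by (auto simp: before_def)

lemma before_trans: "before p x y \<Longrightarrow> before p y z \<Longrightarrow> before p x z"
  using distinct rotate trans trans' unfolding before_def by metis

lemma before_total: "x \<in> Y \<Longrightarrow> y \<in> Y \<Longrightarrow> x \<noteq> y \<Longrightarrow> before p x y \<or> before p y x"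
  using total[of p x y] p by (auto simp: before_def)

lemma before_asym: "before p x y \<Longrightarrow> \<not> before p y x"
  using before_trans before_irrefl by blast

text \<open>A cyclic triple never descends twice in succession. As any two of its three steps are
  successive, at most one step descends.\<close>

lemma cyclic_before:
  assumes "(x, y, z) \<in> S"
  shows "(before p x y \<and> before p y z) \<or> (before p y z \<and> before p z x) \<or>
    (before p z x \<and> before p x y)"
proof -
  have d: "\<not> (before p y x \<and> before p z y)" if "(x, y, z) \<in> S" for x y z
  proof
    assume a: "before p y x \<and> before p z y"
    then have "y \<noteq> p" "x \<noteq> p" by auto
    then have yx: "(p, y, x) \<in> S" using a by (auto simp: before_def)
    have "(p, z, y) \<in> S \<or> z = p" using a by (auto simp: before_def)
    then have "(z, y, x) \<in> S" using yx trans' by blast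
    then show False using that asym by blast
  qed
  have "x \<in> Y" "y \<in> Y" "z \<in> Y" "x \<noteq> y" "y \<noteq> z" "z \<noteq> x"
    using assms in_carrier distinct by blast+
  then show ?thesis
    using d[OF assms] d[OF rotate[OF assms]] d[OF rotate[OF rotate[OF assms]]]
      before_total[of x y] before_total[of y z] before_total[of z x] by blast
qed

text \<open>Cutting the circular order at \<open>p\<close> turns arc masses into distribution functions.\<close>

lemma arc_mass_of_distribution:
  fixes G :: "'b \<Rightarrow> real"
  assumes q: "q \<in> Y" "q \<noteq> p" "G q = 1"
    and G: "G p = 0" "\<And>x. x \<in> Y \<Longrightarrow> 0 \<le> G x \<and> G x \<le> 1"
    and mono: "\<And>x y. x \<in> Y \<Longrightarrow> y \<in> Y \<Longrightarrow> before p x y \<Longrightarrow> G x \<le> G y"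
    and right: "\<And>x e. x \<in> Y \<Longrightarrow> G x < 1 \<Longrightarrow> e > 0 \<Longrightarrow>
      \<exists>z\<in>Y. before p x z \<and> (\<forall>y\<in>Y. before p x y \<and> before p y z \<longrightarrow> G y < G x + e)"
    and left: "\<And>x e. x \<in> Y \<Longrightarrow> 0 < G x \<Longrightarrow> e > 0 \<Longrightarrow>
      \<exists>z\<in>Y. before p z x \<and> (\<forall>y\<in>Y. before p z y \<and> before p y x \<longrightarrow> G x - e < G y)"
  shows "\<exists>m. arc_mass Y S m \<and> m p q = 1"
proof -
  \<comment> \<open>If \<open>y\<close> comes before \<open>x\<close>, the arc from \<open>x\<close>
    to \<open>y\<close> crosses the cut at \<open>p\<close>, which accounts for the summand
    1.\<close>
  define m where "m x y = (if x = y then 0 else if before p x y then G y - G x else 1 + G y - G x)"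
    for x y
  have nonneg: "0 \<le> m x y" if "x \<in> Y" "y \<in> Y" for x y
    using that G(2)[of x] G(2)[of y] mono[of x y] by (auto simp: m_def)
  have compl: "m x y + m y x = 1" if "x \<in> Y" "y \<in> Y" "x \<noteq> y" for x y
    using that before_total[of x y] before_asym[of x y] by (auto simp: m_def)
  have add: "m x z = m x y + m y z" if "(x, y, z) \<in> S" for x y z
  proof -
    have d: "x \<noteq> y" "y \<noteq> z" "x \<noteq> z" using distinct[OF that] by auto
    note c = cyclic_before[OF that]
    consider "before p x y" "before p y z" "before p x z"
      | "before p y z" "\<not> before p x y" "\<not> before p x z"
      | "\<not> before p y z" "before p x y" "\<not> before p x z"
      using c before_asym before_trans by meson
    then show ?thesis by cases (simp_all add: m_def d)
  qed
  have between: "before p x y \<and> before p y z" if "(x, y, z) \<in> S" "before p x z" for x y z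
    using cyclic_before[OF that(1)] that(2) before_asym by blast
  have r: "\<exists>z\<in>Y - {x}. \<forall>y. (x, y, z) \<in> S \<longrightarrow> m x y < e" if x: "x \<in> Y" "e > 0" for x e
  proof (cases "G x < 1")
    case True
    then obtain z where z: "z \<in> Y" "before p x z"
      "\<And>y. y \<in> Y \<Longrightarrow> before p x y \<Longrightarrow> before p y z \<Longrightarrow> G y < G x + e"
      using right x by blast
    have "m x y < e" if "(x, y, z) \<in> S" for y
      using between[OF that z(2)] z(3)[of y] in_carrier[OF that] distinct[OF that] by (simp add: m_def)
    moreover have "z \<noteq> x" using z(2) before_irrefl by blast
    ultimately show ?thesis using z(1) by blast
  next
    case False
    then have "x \<noteq> p" using G(1) by auto
    \<comment> \<open>Since \<open>G x = 1\<close>, no mass remains between \<open>x\<close> and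
      \<open>p\<close>.\<close>
    moreover have "m x y < e" if "(x, y, p) \<in> S" for y
    proof -
      have "before p x y" "y \<in> Y" using that rotate in_carrier by (auto simp: before_def)
      then show ?thesis using False x mono[of x y] G(2)[of y] by (auto simp: m_def)
    qed
    ultimately show ?thesis using p by auto
  qed
  have l: "\<exists>z\<in>Y - {x}. \<forall>y. (z, y, x) \<in> S \<longrightarrow> m y x < e" if x: "x \<in> Y" "e > 0" for x e
  proof -
    consider "0 < G x" | "x = p" | "G x = 0" "x \<noteq> p" using G(2)[OF x(1)] by linarith
    then show ?thesis
    proof cases
      case 1
      then obtain z where z: "z \<in> Y" "before p z x"
        "\<And>y. y \<in> Y \<Longrightarrow> before p z y \<Longrightarrow> before p y x \<Longrightarrow> G x - e < G y"
        using left x by blast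
      have "m y x < e" if "(z, y, x) \<in> S" for y
        using between[OF that z(2)] z(3)[of y] in_carrier[OF that] distinct[OF that] by (simp add: m_def)
      moreover have "z \<noteq> x" using z(2) before_irrefl by blast
      ultimately show ?thesis using z(1) by blast
    next
      case 2
      \<comment> \<open>All mass is used up at \<open>q\<close>, so the arc from \<open>q\<close> to
        the base point is null.\<close>
      have "m y x < e" if "(q, y, x) \<in> S" for y
      proof -
        have y: "before p q y" "y \<in> Y" using that 2 rotate in_carrier by (auto simp: before_def)
        then have "G y = 1" using mono[of q y] q G(2)[of y] by auto
        then show ?thesis using 2 x G(1) by (simp add: m_def)
      qed
      then show ?thesis using q 2 by auto
    next
      case 3
      have "m y x < e" if "(p, y, x) \<in> S" for y
      proof -
        have y: "before p y x" "y \<in> Y" using that in_carrier by (auto simp: before_def)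
        then show ?thesis using mono[of y x] G(2)[of y] 3 x by (simp add: m_def)
      qed
      then show ?thesis using p 3 by auto
    qed
  qed
  have "arc_mass Y S m"
    unfolding arc_mass_def using nonneg compl add r l by (simp add: m_def)
  moreover have "m p q = 1" using q G by (simp add: m_def)
  ultimately show ?thesis by blast
qed

text \<open>A unit mass in the empty gap between \<open>c\<close> and \<open>d\<close>: the
  distribution function jumps at \<open>d\<close>. The gap supplies both one-sided bounds,
  \<open>d\<close> for points before the jump and \<open>c\<close> for points from \<open>d\<close>
  on.\<close>

lemma arc_mass_jump:
  assumes q: "q \<in> Y" and cd: "c \<in> Y" "d \<in> Y" "before p c d" "d = q \<or> before p d q"
    and gap: "\<And>z. z \<in> Y \<Longrightarrow> before p c z \<Longrightarrow> \<not> before p z d"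
  shows "\<exists>m. arc_mass Y S m \<and> m p q = 1"
proof (rule arc_mass_of_distribution)
  define G :: "'b \<Rightarrow> real" where "G x = (if x = d \<or> before p d x then 1 else 0)" for x
  have "d \<noteq> p" using cd before_base(1) by blast
  show "q \<in> Y" "q \<noteq> p" using q cd before_base(1) by blast+
  show "G q = 1" "G p = 0" using cd \<open>d \<noteq> p\<close> by (auto simp: G_def)
  show "0 \<le> G x \<and> G x \<le> 1" for x by (simp add: G_def)
  show "G x \<le> G y" if "x \<in> Y" "y \<in> Y" "before p x y" for x y
    using that before_trans by (auto simp: G_def)
  show "\<exists>z\<in>Y. before p x z \<and> (\<forall>y\<in>Y. before p x y \<and> before p y z \<longrightarrow> G y < G x + e)"
    if "x \<in> Y" "G x < 1" "e > 0" for x e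
    using that cd before_total[of x d] before_asym by (intro bexI[of _ d]) (auto simp: G_def split: if_splits)
  show "\<exists>z\<in>Y. before p z x \<and> (\<forall>y\<in>Y. before p z y \<and> before p y x \<longrightarrow> G x - e < G y)"
    if "x \<in> Y" "0 < G x" "e > 0" for x e
  proof -
    have "x = d \<or> before p d x" using that by (auto simp: G_def split: if_splits)
    then have "before p c x" using cd(3) before_trans by blast
    moreover have "G y = 1" if "y \<in> Y" "before p c y" for y
      using that cd before_total[of y d] gap[of y] by (auto simp: G_def)
    moreover have "G x = 1" using that by (auto simp: G_def split: if_splits)
    ultimately show ?thesis using cd \<open>e > 0\<close> by auto
  qed
qed

text \<open>A Urysohn-type construction: a chain of points indexed by the dyadics in the unit
  interval runs from \<open>p\<close> to \<open>q\<close>, and the distribution function is the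
  supremum of the indices reached.\<close>

lemma arc_mass_dense:
  assumes q: "q \<in> Y" "q \<noteq> p"
    and dense: "\<And>c d. c \<in> Y \<Longrightarrow> d \<in> Y \<Longrightarrow> before p c d \<Longrightarrow> d = q \<or> before p d q \<Longrightarrow>
      \<exists>z\<in>Y. before p c z \<and> before p z d"
  shows "\<exists>m. arc_mass Y S m \<and> m p q = 1"
proof -
  \<comment> \<open>The bound by \<open>q\<close> is built into the relation because density is
    assumed only up to \<open>q\<close>.\<close>
  define R where "R c d \<longleftrightarrow> c \<in> Y \<and> d \<in> Y \<and> before p c d \<and> (d = q \<or> before p d q)" for c d
  have "\<exists>D :: real \<Rightarrow> 'b. D 0 = p \<and> D 1 = q \<and>
     (\<forall>r\<in>dyadics \<inter> {0..1}. \<forall>s\<in>dyadics \<inter> {0..1}. r < s \<longrightarrow> R (D r) (D s))"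
  proof (rule recursion_on_dyadic_fractions)
    show "R p q" using p q by (simp add: R_def)
    show "\<exists>z. R x z \<and> R z y" if "R x y" for x y
      using that dense[of x y] before_trans unfolding R_def by metis
    show "R x z" if "R x y" "R y z" for x y z
      using that before_trans unfolding R_def by metis
  qed
  then obtain D :: "real \<Rightarrow> 'b" where D: "D 0 = p" "D 1 = q"
    and DR: "\<And>r s. r \<in> dyadics \<Longrightarrow> s \<in> dyadics \<Longrightarrow> 0 \<le> r \<Longrightarrow> r < s \<Longrightarrow> s \<le> 1 \<Longrightarrow> R (D r) (D s)"
    by fastforce
  have d01: "(0::real) \<in> dyadics" "(1::real) \<in> dyadics"
    using real_in_dyadics[of 0] real_in_dyadics[of 1] by simp_all
  have DY: "D r \<in> Y" if "r \<in> dyadics" "0 \<le> r" "r \<le> 1" for r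
    using DR[of 0 r] DR[of r 1] that d01 D p by (cases "r = 0") (auto simp: R_def)
  define A where "A x = {r \<in> dyadics. 0 \<le> r \<and> r \<le> 1 \<and> (D r = x \<or> before p (D r) x)}" for x
  define G where "G x = Sup (A x)" for x
  have bdd: "bdd_above (A x)" for x by (rule bdd_aboveI[of _ 1]) (simp add: A_def)
  have A0: "0 \<in> A x" for x using d01 D by (auto simp: A_def)
  have upper: "r \<le> G x" if "r \<in> A x" for r x
    unfolding G_def using that bdd by (rule cSup_upper)
  have least: "G x \<le> u" if "\<And>r. r \<in> A x \<Longrightarrow> r \<le> u" for x u
    unfolding G_def using A0 that by (intro cSup_least) auto
  have G01: "0 \<le> G x \<and> G x \<le> 1" for x
    using upper[OF A0] least[of x 1] by (auto simp: A_def)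
  have lessD: "before p x (D r)" if "x \<in> Y" "r \<in> dyadics" "0 \<le> r" "r \<le> 1" "G x < r" for x r
  proof (rule ccontr)
    assume "\<not> before p x (D r)"
    then have "r \<in> A x" using that before_total[OF that(1) DY[OF that(2-4)]] by (auto simp: A_def)
    then show False using upper that by fastforce
  qed
  have Dless: "before p (D r) x" if r: "r \<in> dyadics" "0 \<le> r" "r < G x" for x r
  proof -
    obtain s where s: "s \<in> A x" "r < s"
      using r(3) least[of x r] by (meson not_le)
    then have "before p (D r) (D s)" using DR[of r s] r by (auto simp: A_def R_def)
    then show ?thesis using s before_trans by (auto simp: A_def)
  qed
  have below: "G y \<le> r" if "before p y (D r)" "r \<in> dyadics" "0 \<le> r" "r \<le> 1" for y r
    using Dless[of r y] that before_asym by (meson not_le)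
  have above: "r \<le> G y" if "before p (D r) y" "r \<in> dyadics" "0 \<le> r" "r \<le> 1" for y r
    using that by (intro upper) (simp add: A_def)
  show ?thesis
  proof (rule arc_mass_of_distribution)
    show "q \<in> Y" "q \<noteq> p" by fact+
    have "1 \<in> A q" using d01 D by (simp add: A_def)
    then show "G q = 1" using upper G01 by (simp add: order_antisym)
    have "G p \<le> 0"
    proof (rule least)
      fix r assume r: "r \<in> A p"
      show "r \<le> 0"
      proof (rule ccontr)
        assume "\<not> r \<le> 0"
        then have "before p p (D r)" using DR[of 0 r] r d01 D by (auto simp: A_def R_def)
        then show False using r by (auto simp: A_def)
      qed
    qed
    then show "G p = 0" using G01 by (simp add: order_antisym)
    show "0 \<le> G x \<and> G x \<le> 1" for x by (rule G01)
    show "G x \<le> G y" if "x \<in> Y" "y \<in> Y" "before p x y" for x y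
      by (rule least, rule upper) (use that before_trans in \<open>auto simp: A_def\<close>)
    show "\<exists>z\<in>Y. before p x z \<and> (\<forall>y\<in>Y. before p x y \<and> before p y z \<longrightarrow> G y < G x + e)"
      if x: "x \<in> Y" "G x < 1" "e > 0" for x e
    proof -
      \<comment> \<open>The chain point with an index strictly between \<open>G x\<close> and
        \<open>G x + e\<close> bounds \<open>x\<close> on the right.\<close>
      obtain r where r: "r \<in> dyadics" "0 \<le> r" "r \<le> 1" "G x < r" "r < G x + e"
        using dyadic_between[of "G x" "min 1 (G x + e)"] G01[of x] x by auto
      have "G y < G x + e" if "before p y (D r)" for y
        using below[OF that r(1-3)] r by linarith
      then show ?thesis using DY[OF r(1-3)] lessD[OF x(1) r(1-4)] by blast
    qed
    show "\<exists>z\<in>Y. before p z x \<and> (\<forall>y\<in>Y. before p z y \<and> before p y x \<longrightarrow> G x - e < G y)"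
      if x: "x \<in> Y" "0 < G x" "e > 0" for x e
    proof -
      obtain r where r: "r \<in> dyadics" "0 \<le> r" "r \<le> 1" "G x - e < r" "r < G x"
        using dyadic_between[of "max 0 (G x - e)" "G x"] G01[of x] x by auto
      have "G x - e < G y" if "before p (D r) y" for y
        using above[OF that r(1-3)] r by linarith
      then show ?thesis using DY[OF r(1-3)] Dless[OF r(1,2,5)] by blast
    qed
  qed
qed

text \<open>Either two neighbours occur on the way from \<open>p\<close> to \<open>q\<close>, or
  that stretch is densely ordered.\<close>

lemma arc_mass_full:
  assumes "q \<in> Y" "q \<noteq> p"
  shows "\<exists>m. arc_mass Y S m \<and> m p q = 1"
  using arc_mass_jump[of q] arc_mass_dense[of q] assms by blast

end

text \<open>Averages the masses concentrated on the two complementary arcs; each arc receives at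
  least one half.\<close>

lemma arc_mass_separating:
  assumes "p \<in> Y" "q \<in> Y" "p \<noteq> q"
  shows "\<exists>m. arc_mass Y S m \<and> 0 < m p q \<and> 0 < m q p"
proof -
  obtain m n where m: "arc_mass Y S m" "m p q = 1" and n: "arc_mass Y S n" "n q p = 1"
    using arc_mass_full[of p q] arc_mass_full[of q p] assms by auto
  have "0 \<le> n p q" "0 \<le> m q p" using m n assms by (simp_all add: arc_mass_def)
  then show ?thesis using arc_mass_average[OF m(1) n(1)] m n by force
qed

end

section \<open>Closure of the image in the torus\<close>

text \<open>Disjoint neighbourhoods are pulled back along the continuous map of a separating
  mass.\<close>

lemma (in circular_order) Hausdorff_interval_topology: "Hausdorff_space (interval_topology Y S)"
  unfolding Hausdorff_space_def
proof (intro allI impI, elim conjE)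
  fix x y assume xy: "x \<in> topspace (interval_topology Y S)" "y \<in> topspace (interval_topology Y S)" "x \<noteq> y"
  then have Y: "x \<in> Y" "y \<in> Y" by simp_all
  obtain m where m: "arc_mass Y S m" "0 < m x y" "0 < m y x"
    using arc_mass_separating[OF Y xy(3)] by blast
  interpret circular_order_mass Y S m by unfold_locales fact
  let ?f = "mass_map x"
  have "continuous_map (interval_topology Y S) euclidean ?f"
    using continuous_mass_map[OF Y(1)] by (simp add: circle_top_def continuous_map_in_subtopology)
  then have op: "openin (interval_topology Y S) {z \<in> Y. ?f z \<in> W}" if "open W" for W
    using that by (simp add: continuous_map_def)
  have "?f x \<noteq> ?f y" using mass_map_eq_iff[OF Y(1) Y] m by auto
  then obtain V W where VW: "open V" "open W" "?f x \<in> V" "?f y \<in> W" "V \<inter> W = {}"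
    by (meson hausdorff)
  show "\<exists>U V. openin (interval_topology Y S) U \<and> openin (interval_topology Y S) V \<and>
      x \<in> U \<and> y \<in> V \<and> disjnt U V"
    using op[OF VW(1)] op[OF VW(2)] VW Y by (fastforce simp: disjnt_def)
qed

text \<open>\<open>separating\<close> gives injectivity and \<open>generating\<close> openness onto
  the image. \<open>dominating\<close> is directedness stated as closed inequalities, so that it
  survives limits. The alternative \<open>U = X\<close> admits an empty family, which occurs when
  the ambient order has one point.\<close>

locale torus_family = circular_order X R for X :: "'a set" and R +
  fixes \<tau> :: "'a topology" and I :: "('a \<Rightarrow> complex) set"
  assumes topspace: "topspace \<tau> = X"
    and family: "I \<subseteq> C_plus X R \<tau>"
    and separating: "\<And>x y. x \<in> X \<Longrightarrow> y \<in> X \<Longrightarrow> x \<noteq> y \<Longrightarrow> \<exists>f\<in>I. f x \<noteq> f y"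
    and dominating: "\<And>f g. f \<in> I \<Longrightarrow> g \<in> I \<Longrightarrow> \<exists>h\<in>I. \<exists>C. \<forall>x\<in>X. \<forall>y\<in>X.
      dist (f x) (f y) \<le> C * dist (h x) (h y) \<and> dist (g x) (g y) \<le> C * dist (h x) (h y)"
    and generating: "\<And>U x. openin \<tau> U \<Longrightarrow> x \<in> U \<Longrightarrow>
      U = X \<or> (\<exists>f\<in>I. \<exists>e>0. \<forall>y\<in>X. dist (f y) (f x) < e \<longrightarrow> y \<in> U)"
begin

section \<open>The diagonal map into the torus and the closure of its image\<close>

definition diag :: "'a \<Rightarrow> ('a \<Rightarrow> complex) \<Rightarrow> complex" where
  "diag x = (\<lambda>f\<in>I. f x)"

definition torus_closure :: "(('a \<Rightarrow> complex) \<Rightarrow> complex) set" where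
  "torus_closure = torus_top I closure_of (diag ` X)"

lemma topspace_torus: "topspace (torus_top I) = I \<rightarrow>\<^sub>E circle"
  by (simp add: torus_top_def circle_top_def)

lemma family_in_circle: "f \<in> I \<Longrightarrow> x \<in> X \<Longrightarrow> f x \<in> circle"
  using family by (auto simp: C_plus_def COP_map_def)

lemma diag_in_torus: "x \<in> X \<Longrightarrow> diag x \<in> I \<rightarrow>\<^sub>E circle"
  by (auto simp: diag_def family_in_circle)

lemma diag_apply [simp]: "f \<in> I \<Longrightarrow> diag x f = f x"
  by (simp add: diag_def)

lemma closure_in_torus: "u \<in> torus_closure \<Longrightarrow> u \<in> I \<rightarrow>\<^sub>E circle"
  unfolding torus_closure_def by (metis closure_of_subset_topspace subsetD topspace_torus)

lemma closure_in_circle: "u \<in> torus_closure \<Longrightarrow> f \<in> I \<Longrightarrow> u f \<in> circle"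
  using closure_in_torus by auto

lemma diag_in_closure: "x \<in> X \<Longrightarrow> diag x \<in> torus_closure"
  unfolding torus_closure_def
  using closure_of_subset[of "diag ` X" "torus_top I"] diag_in_torus
  by (auto simp: topspace_torus)

lemma continuous_map_coordinate:
  assumes "f \<in> I"
  shows "continuous_map (torus_top I) euclidean (\<lambda>u. u f)"
  using continuous_map_product_projection[OF assms, of "\<lambda>_. circle_top"]
  by (simp add: torus_top_def circle_top_def continuous_map_in_subtopology)

lemma openin_coordinate:
  assumes "f \<in> I" "open W"
  shows "openin (torus_top I) {u \<in> I \<rightarrow>\<^sub>E circle. u f \<in> W}"
  using openin_continuous_map_preimage[OF continuous_map_coordinate[OF assms(1)]] assms(2)
  by (simp add: topspace_torus)

text \<open>A basic open set of the product restricts finitely many coordinates; three at a time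
  suffice for the transitivity argument.\<close>

lemma closure_approximation:
  assumes u: "u \<in> torus_closure" and I: "f \<in> I" "g \<in> I" "h \<in> I"
    and W: "open V" "u f \<in> V" "open V'" "u g \<in> V'" "open V''" "u h \<in> V''"
  shows "\<exists>x\<in>X. f x \<in> V \<and> g x \<in> V' \<and> h x \<in> V''"
proof -
  let ?T = "I \<rightarrow>\<^sub>E circle"
  let ?W = "{u \<in> ?T. u f \<in> V} \<inter> ({u \<in> ?T. u g \<in> V'} \<inter> {u \<in> ?T. u h \<in> V''})"
  have "openin (torus_top I) ?W"
    using I W by (intro openin_Int openin_coordinate)
  moreover have "u \<in> ?W" using closure_in_torus[OF u] W by auto
  ultimately have "\<exists>y. y \<in> diag ` X \<and> y \<in> ?W"
    using u[unfolded torus_closure_def in_closure_of] by (elim conjE allE[of _ ?W]) simp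
  then show ?thesis using I by auto
qed

text \<open>One positively oriented coordinate decides the order: otherwise totality gives the
  reversed triple, which the COP map would send to a negatively oriented one.\<close>

lemma family_orient:
  assumes "f \<in> I" "x \<in> X" "y \<in> X" "z \<in> X" "orient (f x) (f y) (f z) > 0"
  shows "(x, y, z) \<in> R"
proof (rule ccontr)
  assume n: "(x, y, z) \<notin> R"
  have d: "distinct [f x, f y, f z]" using assms(5) by (rule orient_pos_distinct)
  then have "(x, z, y) \<in> R" using n total[of x y z] assms by auto
  moreover have "distinct [f x, f z, f y]" using d by auto
  ultimately have "(f x, f z, f y) \<in> circle_order"
    using family assms(1) by (auto simp: C_plus_def COP_map_def)
  then have "orient (f x) (f z) (f y) > 0" by (rule circle_order_imp_orient)
  then show False using assms(5) orient_swap[of "f x" "f y" "f z"] by simp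
qed

text \<open>The points \<open>u\<close>, \<open>v\<close>, \<open>w\<close> are replaced by points
  of \<open>X\<close> one at a time, each keeping both strict inequalities; rotation brings the next
  point to the first slot. In \<open>X\<close> asymmetry is then violated.\<close>

lemma orient_consistent:
  assumes K: "u \<in> torus_closure" "v \<in> torus_closure" "w \<in> torus_closure"
    and I: "f \<in> I" "g \<in> I"
    and f: "orient (u f) (v f) (w f) > 0" and g: "orient (u g) (w g) (v g) > 0"
  shows False
proof -
  obtain x where x: "x \<in> X" "orient (f x) (v f) (w f) > 0" "orient (g x) (w g) (v g) > 0"
    using closure_approximation[OF K(1) I I(2) open_orient _ open_orient _ open_UNIV] f g by fastforce
  then have x': "orient (v f) (w f) (f x) > 0" "orient (v g) (g x) (w g) > 0"
    by (metis orient_rotate)+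
  obtain y where y: "y \<in> X" "orient (f y) (w f) (f x) > 0" "orient (g y) (g x) (w g) > 0"
    using closure_approximation[OF K(2) I I(2) open_orient _ open_orient _ open_UNIV] x' by fastforce
  then have y': "orient (w f) (f x) (f y) > 0" "orient (w g) (g y) (g x) > 0"
    by (metis orient_rotate)+
  obtain z where z: "z \<in> X" "orient (f z) (f x) (f y) > 0" "orient (g z) (g y) (g x) > 0"
    using closure_approximation[OF K(3) I I(2) open_orient _ open_orient _ open_UNIV] y' by fastforce
  have "(z, x, y) \<in> R" "(z, y, x) \<in> R"
    using family_orient I x y z by blast+
  then show False using asym rotate by blast
qed

text \<open>The same successive replacement with four points, ending in a failure of transitivity in
  \<open>X\<close>.\<close>

lemma orient_transitive:
  assumes K: "a \<in> torus_closure" "b \<in> torus_closure" "c \<in> torus_closure" "d \<in> torus_closure"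
    and I: "f \<in> I" "g \<in> I" "h \<in> I"
    and f: "orient (a f) (b f) (c f) > 0" and g: "orient (a g) (c g) (d g) > 0"
    and h: "orient (a h) (d h) (b h) > 0"
  shows False
proof -
  obtain x where x: "x \<in> X" "orient (f x) (b f) (c f) > 0" "orient (g x) (c g) (d g) > 0"
      "orient (h x) (d h) (b h) > 0"
    using closure_approximation[OF K(1) I open_orient _ open_orient _ open_orient] f g h by fastforce
  then have x': "orient (b f) (c f) (f x) > 0" "orient (b h) (h x) (d h) > 0"
    by (metis orient_rotate)+
  obtain y where y: "y \<in> X" "orient (f y) (c f) (f x) > 0" "orient (h y) (h x) (d h) > 0"
    \<comment> \<open>The point \<open>b\<close> occurs only in the conditions on \<open>f\<close>
      and \<open>h\<close>, so \<open>h\<close> fills the third slot with the whole plane as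
      target.\<close>
    using closure_approximation[OF K(2) I(1,3,3) open_orient _ open_orient _ open_UNIV] x' by fastforce
  then have y': "orient (c f) (f x) (f y) > 0" "orient (c g) (d g) (g x) > 0"
    using x(3) by (metis orient_rotate)+
  obtain z where z: "z \<in> X" "orient (f z) (f x) (f y) > 0" "orient (g z) (d g) (g x) > 0"
    using closure_approximation[OF K(3) I(1,2,2) open_orient _ open_orient _ open_UNIV] y' by fastforce
  then have z': "orient (d g) (g x) (g z) > 0" "orient (d h) (h y) (h x) > 0"
    using y(3) by (metis orient_rotate)+
  obtain t where t: "t \<in> X" "orient (g t) (g x) (g z) > 0" "orient (h t) (h y) (h x) > 0"
    using closure_approximation[OF K(4) I(2,3,3) open_orient _ open_orient _ open_UNIV] z' by fastforce
  have "(z, x, y) \<in> R" "(t, x, z) \<in> R" "(t, y, x) \<in> R"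
    using family_orient I x y z t by blast+
  then have "(x, y, z) \<in> R" "(x, z, t) \<in> R" "(t, y, x) \<in> R" using rotate by blast+
  then show False using trans asym by blast
qed

text \<open>The inequality is closed in each argument, so it extends to the closure first in one
  argument, with the other in the image, and then in the other.\<close>

lemma dist_le_closure:
  assumes I: "f \<in> I" "h \<in> I"
    and le: "\<And>x y. x \<in> X \<Longrightarrow> y \<in> X \<Longrightarrow> dist (f x) (f y) \<le> C * dist (h x) (h y)"
    and u: "u \<in> torus_closure" and v: "v \<in> torus_closure"
  shows "dist (u f) (v f) \<le> C * dist (u h) (v h)"
proof -
  have cont: "continuous_map (torus_top I) euclideanreal (\<lambda>u. dist (u k) s)" if "k \<in> I" for k s
    using continuous_map_compose[OF continuous_map_coordinate[OF that], of euclideanreal "\<lambda>z. dist z s"]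
    by (simp add: comp_def continuous_on_dist)
  have closed: "closedin (torus_top I) {u \<in> topspace (torus_top I). dist (u f) s \<le> C * dist (u h) t}"
    for s t
  proof -
    have "continuous_map (torus_top I) euclideanreal (\<lambda>u. dist (u f) s - C * dist (u h) t)"
      using I by (intro continuous_map_diff continuous_map_real_mult_left cont)
    from closedin_continuous_map_preimage[OF this, of "{..0}"] show ?thesis by simp
  qed
  have 1: "dist (u f) (f y) \<le> C * dist (u h) (h y)" if "y \<in> X" for y
    using u unfolding torus_closure_def
    by (rule forall_in_closure_of) (use closed le I that in auto)
  then have 2: "dist (f y) (u f) \<le> C * dist (h y) (u h)" if "y \<in> X" for y
    using that by (simp add: dist_commute)
  have "dist (v f) (u f) \<le> C * dist (v h) (u h)"
    using v unfolding torus_closure_def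
    by (rule forall_in_closure_of) (use closed 2 I in auto)
  then show ?thesis by (simp add: dist_commute)
qed

text \<open>The inequality is what passes to limits; the implication between equalities, known on
  \<open>X\<close> alone, need not extend to the closure.\<close>

lemma closure_dominating:
  assumes "f \<in> I" "g \<in> I"
  shows "\<exists>h\<in>I. \<forall>u\<in>torus_closure. \<forall>v\<in>torus_closure. u h = v h \<longrightarrow> u f = v f \<and> u g = v g"
proof -
  obtain h C where h: "h \<in> I" "\<And>x y. x \<in> X \<Longrightarrow> y \<in> X \<Longrightarrow>
      dist (f x) (f y) \<le> C * dist (h x) (h y) \<and> dist (g x) (g y) \<le> C * dist (h x) (h y)"
    using dominating[OF assms] by blast
  then show ?thesis
    using dist_le_closure[of f h C] dist_le_closure[of g h C] assms
    by (intro bexI[OF _ h(1)]) fastforce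
qed

lemma closure_separating:
  assumes "u \<in> torus_closure" "v \<in> torus_closure" "u \<noteq> v"
  shows "\<exists>f\<in>I. u f \<noteq> v f"
  using PiE_ext[OF closure_in_torus[OF assms(1)] closure_in_torus[OF assms(2)]] assms(3) by blast

text \<open>Each pair is separated by some coordinate; dominating \<open>f\<close> and
  \<open>g\<close> by \<open>h\<close>, then \<open>h\<close> and \<open>k\<close> by
  \<open>l\<close>, collects all three separations in \<open>l\<close>.\<close>

lemma closure_three_point_separating:
  assumes K: "u \<in> torus_closure" "v \<in> torus_closure" "w \<in> torus_closure" and d: "distinct [u, v, w]"
  shows "\<exists>h\<in>I. distinct [u h, v h, w h]"
proof -
  obtain f where f: "f \<in> I" "u f \<noteq> v f" using closure_separating[of u v] K d by auto
  obtain g where g: "g \<in> I" "u g \<noteq> w g" using closure_separating[of u w] K d by auto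
  obtain k where k: "k \<in> I" "v k \<noteq> w k" using closure_separating[of v w] K d by auto
  obtain h where h: "h \<in> I" "\<And>u v. u \<in> torus_closure \<Longrightarrow> v \<in> torus_closure \<Longrightarrow> u h = v h \<Longrightarrow> u f = v f \<and> u g = v g"
    using closure_dominating[OF f(1) g(1)] by blast
  obtain l where l: "l \<in> I" "\<And>u v. u \<in> torus_closure \<Longrightarrow> v \<in> torus_closure \<Longrightarrow> u l = v l \<Longrightarrow> u h = v h \<and> u k = v k"
    using closure_dominating[OF h(1) k(1)] by blast
  show ?thesis
    using f g k h(2)[of u v] h(2)[of u w] l(2)[of u v] l(2)[of u w] l(2)[of v w] K
    by (intro bexI[OF _ l(1)]) auto
qed

abbreviation closure_rel where
  "closure_rel \<equiv> torus_rel I \<inter> torus_closure \<times> torus_closure \<times> torus_closure"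

text \<open>A single positive coordinate suffices, since \<open>orient_consistent\<close> rules out
  a negative one elsewhere. The relation thereby becomes an open condition.\<close>

lemma closure_rel_iff:
  assumes K: "u \<in> torus_closure" "v \<in> torus_closure" "w \<in> torus_closure"
  shows "(u, v, w) \<in> closure_rel \<longleftrightarrow> (\<exists>f\<in>I. orient (u f) (v f) (w f) > 0)"
proof -
  have iff: "(u f, v f, w f) \<in> circle_order \<longleftrightarrow> orient (u f) (v f) (w f) > 0" if "f \<in> I" for f
    using that K closure_in_circle by (intro circle_order_iff_orient) auto
  have cases: "orient (u f) (v f) (w f) > 0 \<or> orient (u f) (w f) (v f) > 0"
    if "f \<in> I" "distinct [u f, v f, w f]" for f
    using circle_order_cases[of "u f" "v f" "w f"] circle_order_imp_orient that K closure_in_circle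
    by blast
  have mem: "(u, v, w) \<in> closure_rel \<longleftrightarrow> (\<exists>f\<in>I. distinct [u f, v f, w f]) \<and>
      (\<forall>f\<in>I. distinct [u f, v f, w f] \<longrightarrow> (u f, v f, w f) \<in> circle_order)"
    using K closure_in_torus by (simp add: torus_rel_def)
  show ?thesis
    unfolding mem using iff cases orient_consistent[OF K] orient_pos_distinct by meson
qed

lemma circular_order_closure: "circular_order_on torus_closure closure_rel"
proof -
  let ?K = torus_closure
  have cyc: "(v, w, u) \<in> closure_rel" if "(u, v, w) \<in> closure_rel" for u v w
    using that closure_rel_iff[of u v w] closure_rel_iff[of v w u] by (auto simp: orient_rotate)
  have as: "(w, v, u) \<notin> closure_rel" if "(u, v, w) \<in> closure_rel" for u v w
  proof
    assume "(w, v, u) \<in> closure_rel"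
    then have "(u, w, v) \<in> closure_rel" using cyc by blast
    then show False
      using that closure_rel_iff[of u v w] closure_rel_iff[of u w v] orient_consistent[of u v w]
      by blast
  qed
  have tot: "(u, v, w) \<in> closure_rel \<or> (u, w, v) \<in> closure_rel"
    if K: "u \<in> ?K" "v \<in> ?K" "w \<in> ?K" and d: "distinct [u, v, w]" for u v w
  proof -
    obtain f where f: "f \<in> I" "distinct [u f, v f, w f]"
      using closure_three_point_separating[OF K d] by blast
    then have "orient (u f) (v f) (w f) > 0 \<or> orient (u f) (w f) (v f) > 0"
      using circle_order_cases[of "u f" "v f" "w f"] circle_order_imp_orient K closure_in_circle
      by blast
    then show ?thesis using closure_rel_iff K f by blast
  qed
  have tr: "(a, b, d) \<in> closure_rel"
    if abc: "(a, b, c) \<in> closure_rel" and acd: "(a, c, d) \<in> closure_rel" for a b c d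
  proof (rule ccontr)
    assume n: "(a, b, d) \<notin> closure_rel"
    have K: "a \<in> ?K" "b \<in> ?K" "c \<in> ?K" "d \<in> ?K" using abc acd by auto
    obtain f where f: "f \<in> I" "orient (a f) (b f) (c f) > 0" using abc closure_rel_iff K by blast
    obtain g where g: "g \<in> I" "orient (a g) (c g) (d g) > 0" using acd closure_rel_iff K by blast
    \<comment> \<open>If \<open>b = d\<close>, the two hypotheses are opposite orientations of one
      triple.\<close>
    have "b \<noteq> d" using as abc acd cyc by blast
    moreover have "a \<noteq> b" "a \<noteq> d"
      using orient_pos_distinct[OF f(2)] orient_pos_distinct[OF g(2)] by auto
    ultimately have "(a, d, b) \<in> closure_rel" using tot[of a b d] n K by auto
    then obtain h where "h \<in> I" "orient (a h) (d h) (b h) > 0" using closure_rel_iff K by blast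
    then show False using orient_transitive[OF K f(1) g(1)] f g by blast
  qed
  show ?thesis
    unfolding circular_order_on_def using cyc as tot tr by (intro conjI) blast+
qed

sublocale closure: circular_order torus_closure closure_rel
  by unfold_locales (rule circular_order_closure)

section \<open>Compactness and the interval topology of the closure\<close>

lemma compact_space_closure: "compact_space (subtopology (torus_top I) torus_closure)"
proof -
  have "compact_space circle_top"
    unfolding circle_top_def circle_def by (simp add: compact_space_subtopology)
  then have "compact_space (torus_top I)"
    unfolding torus_top_def by (simp add: compact_space_product_topology)
  then have "compactin (torus_top I) torus_closure"
    unfolding torus_closure_def by (simp add: closedin_compact_space)
  then show ?thesis by (rule compact_space_subtopology)
qed

text \<open>For \<open>u \<noteq> v\<close> the set is the open arc from \<open>v\<close> to
  \<open>u\<close>, a union of open coordinate conditions. For \<open>u = v\<close> it is the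
  complement of a point, and Hausdorffness is used instead.\<close>

lemma openin_closure_Diff_closed_arc:
  assumes "u \<in> torus_closure" "v \<in> torus_closure"
  shows "openin (subtopology (torus_top I) torus_closure) (torus_closure - closed_arc closure_rel u v)"
proof (cases "u = v")
  case True
  have "Hausdorff_space (torus_top I)"
    unfolding torus_top_def circle_top_def
    by (simp add: Hausdorff_space_product_topology Hausdorff_space_subtopology)
  then have "closedin (torus_top I) {u}"
    using closure_in_torus[OF assms(1)] closedin_Hausdorff_singleton[of "torus_top I" u]
    by (simp add: topspace_torus)
  then have "closedin (subtopology (torus_top I) torus_closure) {u}"
    using assms by (simp add: closedin_subset_topspace)
  moreover have "topspace (subtopology (torus_top I) torus_closure) = torus_closure"
    using closure_in_torus by (auto simp: topspace_torus)
  ultimately show ?thesis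
    using True by (simp add: closedin_def closure.closed_arc_same)
next
  case False
  have arc: "w \<in> torus_closure - closed_arc closure_rel u v \<longleftrightarrow> (v, w, u) \<in> closure_rel" for w
  proof
    assume "w \<in> torus_closure - closed_arc closure_rel u v"
    then have "w \<in> torus_closure" "w \<noteq> u" "w \<noteq> v" "(u, w, v) \<notin> closure_rel"
      by (auto simp: closed_arc_def open_arc_def)
    then have "(u, v, w) \<in> closure_rel" using closure.total[of u v w] assms False by auto
    then show "(v, w, u) \<in> closure_rel" by (rule closure.rotate)
  next
    assume w: "(v, w, u) \<in> closure_rel"
    show "w \<in> torus_closure - closed_arc closure_rel u v"
      using closure.in_carrier[OF w] closure.distinct[OF w] closure.asym[OF w]
      by (auto simp: closed_arc_def open_arc_def)
  qed
  have "w \<in> torus_closure - closed_arc closure_rel u v \<longleftrightarrow>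
      w \<in> torus_closure \<inter> (\<Union>f\<in>I. {w \<in> I \<rightarrow>\<^sub>E circle. w f \<in> {z. orient z (u f) (v f) > 0}})" for w
  proof (cases "w \<in> torus_closure")
    case True
    have "(v, w, u) \<in> closure_rel \<longleftrightarrow> (\<exists>f\<in>I. orient (w f) (u f) (v f) > 0)"
      unfolding closure_rel_iff[OF assms(2) True assms(1)] orient_rotate[of "w _" "u _" "v _"] by simp
    then show ?thesis
      unfolding arc using True closure_in_torus[OF True] by simp
  qed simp
  then have "torus_closure - closed_arc closure_rel u v =
      torus_closure \<inter> (\<Union>f\<in>I. {w \<in> I \<rightarrow>\<^sub>E circle. w f \<in> {z. orient z (u f) (v f) > 0}})"
    by blast
  moreover have "openin (torus_top I) (\<Union>f\<in>I. {w \<in> I \<rightarrow>\<^sub>E circle. w f \<in> {z. orient z (u f) (v f) > 0}})"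
    using openin_coordinate[OF _ open_orient] by (intro openin_Union) blast
  ultimately show ?thesis by (auto simp: openin_subtopology_Int2)
qed

lemma compact_COTS_closure:
  "compact_COTS torus_closure closure_rel (subtopology (torus_top I) torus_closure)"
proof -
  let ?T = "subtopology (torus_top I) torus_closure"
  have top: "topspace ?T = torus_closure"
    using closure_in_torus by (auto simp: topspace_torus)
  have "continuous_map ?T (interval_topology torus_closure closure_rel) id"
    unfolding interval_topology_def continuous_on_generated_topo_iff
  proof (intro conjI allI impI)
    fix U assume U: "U \<in> interval_base torus_closure closure_rel"
    then have "U \<subseteq> torus_closure" by (auto simp: interval_base_def)
    then have "id -` U \<inter> topspace ?T = U" unfolding top by auto
    moreover have "openin ?T torus_closure" using openin_topspace[of ?T] unfolding top .
    then have "openin ?T U"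
      using U openin_closure_Diff_closed_arc unfolding interval_base_def by blast
    ultimately show "openin ?T (id -` U \<inter> topspace ?T)" by simp
  qed (unfold top, auto simp: interval_base_def)
  \<comment> \<open>A continuous bijection from a compact space onto a Hausdorff space is a
    homeomorphism; for the identity the topologies then coincide.\<close>
  then have "homeomorphic_map ?T (interval_topology torus_closure closure_rel) id"
    using compact_space_closure closure.Hausdorff_interval_topology
    by (intro continuous_imp_homeomorphic_map) (unfold top, simp_all)
  then show ?thesis
    using circular_order_closure compact_space_closure by (simp add: compact_COTS_def)
qed

text \<open>Openness onto the image is local: by \<open>generating\<close>, a ball in a single
  coordinate isolates a neighbourhood inside \<open>U\<close>.\<close>

lemma embedding_diag: "embedding_map \<tau> (torus_top I) diag"
proof -
  let ?D = "subtopology (torus_top I) (diag ` X)"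
  have inj: "inj_on diag X"
    using separating by (metis diag_apply inj_onI)
  have cont: "continuous_map \<tau> (torus_top I) diag"
    unfolding torus_top_def continuous_map_componentwise
  proof (intro conjI ballI)
    show "continuous_map \<tau> circle_top (\<lambda>x. diag x f)" if "f \<in> I" for f
      using that family by (auto simp: C_plus_def)
  qed (auto simp: diag_def)
  have "openin ?D (diag ` U)" if U: "openin \<tau> U" for U
  proof (subst openin_subopen, intro ballI)
    fix v assume "v \<in> diag ` U"
    then obtain x where x: "x \<in> U" "v = diag x" by blast
    have UX: "U \<subseteq> X" using openin_subset[OF U] topspace by simp
    consider "U = X" | f e where "f \<in> I" "e > 0" "\<And>y. y \<in> X \<Longrightarrow> dist (f y) (f x) < e \<Longrightarrow> y \<in> U"
      using generating[OF U x(1)] by blast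
    then show "\<exists>T. openin ?D T \<and> v \<in> T \<and> T \<subseteq> diag ` U"
    proof cases
      case 1
      have "topspace ?D = diag ` X" using diag_in_torus by (auto simp: topspace_torus)
      then have "openin ?D (diag ` X)" using openin_topspace[of ?D] by simp
      then show ?thesis using 1 x by blast
    next
      case 2
      let ?W = "{w \<in> I \<rightarrow>\<^sub>E circle. w f \<in> ball (f x) e}"
      have "openin ?D (diag ` X \<inter> ?W)"
        using openin_coordinate[of f "ball (f x) e"] 2 by (auto simp: openin_subtopology_Int2)
      moreover have "v \<in> diag ` X \<inter> ?W" using x UX 2 diag_in_torus[of x] by (simp add: subset_iff)
      moreover have "diag ` X \<inter> ?W \<subseteq> diag ` U" using 2 by (auto simp: dist_commute)
      ultimately show ?thesis by blast
    qed
  qed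
  then show ?thesis
    unfolding embedding_map_def topspace using inj cont
    by (intro bijective_open_imp_homeomorphic_map)
      (auto simp: open_map_def continuous_map_in_subtopology topspace topspace_torus diag_in_torus
        dest: diag_in_torus)
qed

lemma family_three_point_separating: 
  assumes "x \<in> X" "y \<in> X" "z \<in> X" "distinct [x, y, z]"
  shows "\<exists>f\<in>I. distinct [f x, f y, f z]"
proof -
  have inj: "diag a \<noteq> diag b" if "a \<in> X" "b \<in> X" "a \<noteq> b" for a b
    using separating[OF that] diag_apply by metis
  have "distinct [diag x, diag y, diag z]" using assms inj by simp
  then show ?thesis
    using closure_three_point_separating[of "diag x" "diag y" "diag z"] assms diag_in_closure by auto
qed

lemma diag_rel_iff:
  assumes X: "x \<in> X" "y \<in> X" "z \<in> X"
  shows "(x, y, z) \<in> R \<longleftrightarrow> (diag x, diag y, diag z) \<in> torus_rel I"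
proof -
  have "(diag x, diag y, diag z) \<in> torus_rel I \<longleftrightarrow> (\<exists>f\<in>I. orient (f x) (f y) (f z) > 0)"
    using closure_rel_iff[of "diag x" "diag y" "diag z"] X diag_in_closure by auto
  moreover have "\<exists>f\<in>I. orient (f x) (f y) (f z) > 0" if R: "(x, y, z) \<in> R"
  proof -
    obtain f where f: "f \<in> I" "distinct [f x, f y, f z]"
      using family_three_point_separating[OF X] distinct[OF R] by auto
    then have "(f x, f y, f z) \<in> circle_order"
      using R family by (auto simp: C_plus_def COP_map_def)
    then show ?thesis using f circle_order_imp_orient by blast
  qed
  ultimately show ?thesis using family_orient X by blast
qed

theorem torus_family_embedding:
  "three_point_separating X (C_plus X R \<tau>) \<and>
    top_order_embedding \<tau> R (torus_top I) (torus_rel I) diag \<and>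
    compact_COTS torus_closure closure_rel (subtopology (torus_top I) torus_closure)"
proof (intro conjI)
  show "three_point_separating X (C_plus X R \<tau>)"
    unfolding three_point_separating_def using family_three_point_separating family by blast
  show "top_order_embedding \<tau> R (torus_top I) (torus_rel I) diag"
    unfolding top_order_embedding_def topspace using embedding_diag diag_rel_iff by blast
qed (rule compact_COTS_closure)

end

section \<open>Coordinates from the ambient circular order\<close>

context circular_order
begin

text \<open>Averaging puts mass on both sides of \<open>p\<close>, which keeps a closed arc from
  \<open>a\<close> to \<open>b\<close> that misses \<open>p\<close> away from it. The case
  \<open>a = b\<close> is included.\<close>

lemma arc_mass_pair_separating:
  assumes "p \<in> Y" "a \<in> Y" "b \<in> Y" "p \<noteq> a" "p \<noteq> b"
  shows "\<exists>m. arc_mass Y S m \<and> 0 < m p a \<and> 0 < m b p"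
proof -
  obtain m n where m: "arc_mass Y S m" "0 < m p a" and n: "arc_mass Y S n" "0 < n b p"
    using arc_mass_separating[of p a] arc_mass_separating[of p b] assms by blast
  have "0 \<le> n p a" "0 \<le> m b p" using m n assms by (simp_all add: arc_mass_def)
  then show ?thesis using arc_mass_average[OF m(1) n(1)] m n by force
qed

text \<open>The chord for \<open>m\<close> is at most \<open>2 * pi\<close> times the shorter
  \<open>m\<close>-arc, that arc at most twice the shorter \<open>k\<close>-arc, and the latter at
  most the chord for \<open>k\<close>.\<close>

lemma arc_mass_dominated:
  assumes "arc_mass Y S m" "arc_mass Y S k"
    and le: "\<And>x y. x \<in> Y \<Longrightarrow> y \<in> Y \<Longrightarrow> m x y \<le> 2 * k x y"
    and p: "p \<in> Y" and xy: "x \<in> Y" "y \<in> Y"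
  shows "dist (wrap (m p x)) (wrap (m p y)) \<le> 4 * pi * dist (wrap (k p x)) (wrap (k p y))"
proof -
  interpret m: circular_order_mass Y S m by unfold_locales fact
  interpret k: circular_order_mass Y S k by unfold_locales fact
  have "dist (wrap (m p x)) (wrap (m p y)) \<le> 2 * pi * min (m x y) (m y x)"
    using m.dist_mass_map_le[OF p xy] m.dist_mass_map_le[OF p xy(2,1)]
    by (simp add: m.mass_map_def min_def dist_commute)
  also have "min (m x y) (m y x) \<le> 2 * min (k x y) (k y x)"
    using le xy by (simp add: min_le_iff_disj min_mult_distrib_left)
  also have "min (k x y) (k y x) \<le> dist (wrap (k p x)) (wrap (k p y))"
    using k.dist_mass_map_ge[OF p xy] by (simp add: k.mass_map_def)
  finally show ?thesis by simp
qed

definition mass_maps :: "'b \<Rightarrow> ('a \<Rightarrow> 'b) \<Rightarrow> ('a \<Rightarrow> complex) set" where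
  "mass_maps p i = {\<lambda>x. wrap (m p (i x)) | m. arc_mass Y S m}"

lemma torus_family_mass_maps:
  fixes i :: "'a \<Rightarrow> 'b"
  assumes X: "circular_order_on X R" "topspace \<tau> = X"
    and i: "top_order_embedding \<tau> R (interval_topology Y S) S i"
    and p: "p \<in> Y"
  shows "torus_family X R \<tau> (mass_maps p i)"
proof -
  interpret X: circular_order X R by unfold_locales fact
  have emb: "homeomorphic_map \<tau> (subtopology (interval_topology Y S) (i ` X)) i"
    using i X by (simp add: top_order_embedding_def embedding_map_def)
  then have cont: "continuous_map \<tau> (interval_topology Y S) i"
    and inj: "inj_on i X"
    and op: "open_map \<tau> (subtopology (interval_topology Y S) (i ` X)) i"
    using X(2) unfolding homeomorphic_eq_everything_map continuous_map_in_subtopology by blast+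
  have iY: "i x \<in> Y" if "x \<in> X" for x
    using continuous_map_image_subset_topspace[OF cont] that X(2) by auto
  have iR: "(i a, i b, i c) \<in> S" if "(a, b, c) \<in> R" for a b c
    using that X.in_carrier[OF that] i X(2) by (auto simp: top_order_embedding_def)
  have fam: "f \<in> C_plus X R \<tau>" if fI: "f \<in> mass_maps p i" for f
  proof -
    obtain m where m: "arc_mass Y S m" and f: "f = (\<lambda>x. wrap (m p (i x)))"
      using fI by (auto simp: mass_maps_def)
    interpret circular_order_mass Y S m by unfold_locales fact
    have fi: "f x = mass_map p (i x)" for x by (simp add: f mass_map_def)
    have "continuous_map \<tau> circle_top (mass_map p \<circ> i)"
      using cont continuous_mass_map[OF p] by (rule continuous_map_compose)
    then have "continuous_map \<tau> circle_top f" by (simp add: comp_def fi[abs_def])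
    moreover have "COP_map X R circle circle_order f"
      unfolding COP_map_def
    proof (intro conjI allI ballI impI)
      show "(f a, f b, f c) \<in> circle_order" if "(a, b, c) \<in> R \<and> distinct [f a, f b, f c]" for a b c
        using that mass_map_circle_order[OF p iR] by (simp add: fi)
      have arc: "i z \<in> closed_arc S (i x) (i y)" if "z \<in> closed_arc R x y" for x y z
        using that iR by (auto simp: closed_arc_def open_arc_def)
      show "f constant_on closed_arc R x y \<or> f constant_on closed_arc R y x"
        if "x \<in> X" "y \<in> X" "f x = f y" for x y
        using mass_map_eq_constant[OF p iY[OF that(1)] iY[OF that(2)]] that(3) arc
        unfolding constant_on_def fi by blast
    qed (simp add: fi)
    ultimately show ?thesis by (simp add: C_plus_def)
  qed
  have sep: "\<exists>f\<in>mass_maps p i. f x \<noteq> f y" if "x \<in> X" "y \<in> X" "x \<noteq> y" for x y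
  proof -
    have Y: "i x \<in> Y" "i y \<in> Y" "i x \<noteq> i y" using that iY inj by (auto simp: inj_on_eq_iff)
    obtain m where m: "arc_mass Y S m" "0 < m (i x) (i y)" "0 < m (i y) (i x)"
      using arc_mass_separating[OF Y] by blast
    interpret circular_order_mass Y S m by unfold_locales fact
    have "mass_map p (i x) \<noteq> mass_map p (i y)"
      using m Y by (simp add: mass_map_eq_iff[OF p])
    then show ?thesis using m(1) by (auto simp: mass_maps_def mass_map_def)
  qed
  have dom: "\<exists>h\<in>mass_maps p i. \<exists>C. \<forall>x\<in>X. \<forall>y\<in>X.
      dist (f x) (f y) \<le> C * dist (h x) (h y) \<and> dist (g x) (g y) \<le> C * dist (h x) (h y)"
    if fg: "f \<in> mass_maps p i" "g \<in> mass_maps p i" for f g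
  proof -
    obtain m n where m: "arc_mass Y S m" "f = (\<lambda>x. wrap (m p (i x)))"
      and n: "arc_mass Y S n" "g = (\<lambda>x. wrap (n p (i x)))"
      using fg by (auto simp: mass_maps_def)
    define k where "k x y = (m x y + n x y) / 2" for x y
    have k: "arc_mass Y S k"
      using arc_mass_average[OF m(1) n(1)] by (simp add: k_def[abs_def])
    have le: "m x y \<le> 2 * k x y" "n x y \<le> 2 * k x y" if "x \<in> Y" "y \<in> Y" for x y
      using m(1) n(1) that by (simp_all add: arc_mass_def k_def)
    define h where "h x = wrap (k p (i x))" for x
    have "dist (f x) (f y) \<le> 4 * pi * dist (h x) (h y) \<and> dist (g x) (g y) \<le> 4 * pi * dist (h x) (h y)"
      if "x \<in> X" "y \<in> X" for x y
      unfolding m(2) n(2) h_def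
      by (intro conjI arc_mass_dominated[OF m(1) k le(1)] arc_mass_dominated[OF n(1) k le(2)] p iY that)
    moreover have "h \<in> mass_maps p i" using k unfolding mass_maps_def h_def[abs_def] by blast
    ultimately show ?thesis by blast
  qed
  have gen: "U = X \<or> (\<exists>f\<in>mass_maps p i. \<exists>e>0. \<forall>y\<in>X. dist (f y) (f x) < e \<longrightarrow> y \<in> U)"
    if U: "openin \<tau> U" "x \<in> U" for U x
  proof -
    have UX: "U \<subseteq> X" using openin_subset[OF U(1)] X(2) by simp
    have "openin (subtopology (interval_topology Y S) (i ` X)) (i ` U)"
      using op U(1) by (simp add: open_map_def)
    then obtain W where W: "openin (interval_topology Y S) W" "i ` U = W \<inter> i ` X"
      by (auto simp: openin_subtopology)
    have inU: "y \<in> U" if "y \<in> X" "i y \<in> W" for y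
    proof -
      have "i y \<in> i ` U" using that W(2) by blast
      then show ?thesis using that(1) UX inj by (auto simp: inj_on_def)
    qed
    have "i x \<in> W" using W(2) U(2) by blast
    \<comment> \<open>As \<open>interval_base\<close> is a genuine base, one arc complement, and
      hence one coordinate, is enough.\<close>
    then obtain B where B: "B \<in> interval_base Y S" "i x \<in> B" "B \<subseteq> W"
      using W(1) unfolding openin_interval_topology[OF circular] union_of_def by blast
    show ?thesis
    proof (cases "B = Y")
      case True
      then have "U = X" using inU iY B(3) UX by blast
      then show ?thesis ..
    next
      case False
      then obtain a b where ab: "a \<in> Y" "b \<in> Y" "B = Y - closed_arc S a b"
        using B(1) by (auto simp: interval_base_def)
      have x: "i x \<in> Y" "i x \<notin> closed_arc S a b" using B(2) ab by auto
      then have "i x \<noteq> a" "i x \<noteq> b" by (auto simp: closed_arc_def)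
      then obtain m where m: "arc_mass Y S m" "0 < m (i x) a" "0 < m b (i x)"
        using arc_mass_pair_separating x(1) ab by blast
      interpret circular_order_mass Y S m by unfold_locales fact
      define f where "f y = mass_map p (i y)" for y
      have "y \<in> U" if y: "y \<in> X" "dist (f y) (f x) < min (m (i x) a) (m b (i x))" for y
      proof -
        have "i y \<notin> closed_arc S a b"
          using mass_map_avoids_closed_arc[OF p x(1) ab(1,2) x(2), of "i y"] y(2)
          unfolding f_def by linarith
        then show ?thesis using inU[OF y(1)] iY[OF y(1)] ab(3) B(3) by blast
      qed
      moreover have "0 < min (m (i x) a) (m b (i x))" using m by simp
      moreover have "f \<in> mass_maps p i"
        using m(1) unfolding mass_maps_def f_def[abs_def] mass_map_def by blast
      ultimately show ?thesis by blast
    qed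
  qed
  show ?thesis
  proof unfold_locales
    show "mass_maps p i \<subseteq> C_plus X R \<tau>" using fam by blast
  qed (fact X(2) sep dom gen)+
qed

end

lemma torus_family_exists:
  fixes \<tau> :: "'a topology"
  assumes "GCOTS TYPE('b) X R \<tau>"
  shows "\<exists>I. torus_family X R \<tau> I"
proof -
  obtain Y :: "'b set" and S i where X: "topspace \<tau> = X" "circular_order_on X R"
    and Y: "circular_order_on Y S" and i: "top_order_embedding \<tau> R (interval_topology Y S) S i"
    using assms by (auto simp: GCOTS_def)
  interpret circular_order Y S by unfold_locales fact
  show ?thesis
  proof (cases "X = {}")
    case True
    \<comment> \<open>The ambient set may be empty too, leaving no base point; the empty family
      serves.\<close>
    then have "torus_family X R \<tau> {}"
      using X openin_subset[of \<tau>] by unfold_locales auto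
    then show ?thesis ..
  next
    case False
    then obtain x where "x \<in> X" by blast
    moreover have "continuous_map \<tau> (interval_topology Y S) i"
      using i by (auto simp: top_order_embedding_def embedding_map_def homeomorphic_eq_everything_map
          continuous_map_in_subtopology)
    ultimately have "i x \<in> Y"
      using continuous_map_image_subset_topspace X(1) by fastforce
    then show ?thesis using torus_family_mass_maps[OF X(2,1) i] by blast
  qed
qed

theorem proposition8p11:
  fixes X :: "'a set" and R :: "('a \<times> 'a \<times> 'a) set" and \<tau> :: "'a topology"
  assumes "GCOTS TYPE('b) X R \<tau>"
  shows "three_point_separating X (C_plus X R \<tau>) \<and>
    (\<exists>(I :: ('a \<Rightarrow> complex) set) \<nu>.
       top_order_embedding \<tau> R (torus_top I) (torus_rel I) \<nu> \<and>
       (let K = torus_top I closure_of (\<nu> ` X)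
        in compact_COTS K (torus_rel I \<inter> K \<times> K \<times> K) (subtopology (torus_top I) K)))"
proof -
  obtain I where "torus_family X R \<tau> I" using torus_family_exists[OF assms] by blast
  then interpret torus_family X R \<tau> I .
  show ?thesis
    using torus_family_embedding unfolding torus_closure_def Let_def by blast
qed

end
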